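(* There are polynomial-time algorithms that, given a weightable digraph $G$ as input: - find a weighting of $G$; and - test whether a given function on the edge set of $G$ is a weighting.
   Context: Digraphs are finite and may have loops or parallel edges. A dicycle is a directed cycle. A weighting of a digraph $G$ is a real-valued function $w:E(G)\to\mathbb{R}$ such that $\sum_{e\in E(C)}w(e)=1$ for every dicycle $C$ of $G$; $G$ is weightable if it admits a weighting. *)

theory Defs
  imports
    "Graph_Theory.Digraph"
    "Graph_Theory.Arc_Walk"
    "HOL-Library.Log_Nat"
    "HOL-Computational_Algebra.Polynomial"
begin

section \<open>Weightings of digraphs\<close>

text \<open>
  Finite digraphs with loops and parallel arcs are exactly the instances of the locale
  \<^locale>\<open>fin_digraph\<close>. A \<^const>\<open>pre_digraph.cycle\<close> is a nonempty closed walk, given by its list of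
  arcs, without repeated vertices (hence without repeated arcs); a loop is such a cycle.
\<close>

definition weighting :: "('a, 'b) pre_digraph \<Rightarrow> ('b \<Rightarrow> real) \<Rightarrow> bool" where
  "weighting G w \<longleftrightarrow> (\<forall>C. pre_digraph.cycle G C \<longrightarrow> (\<Sum>e\<in>set C. w e) = 1)"

definition weightable :: "('a, 'b) pre_digraph \<Rightarrow> bool" where
  "weightable G \<longleftrightarrow> (\<exists>w. weighting G w)"


section \<open>The machine model: a logarithmic-cost RAM\<close>

text \<open>
  Algorithms are programs of a random access machine with logarithmic cost, written as structured
  (while) programs. A program has finitely many named memory banks, each a sequence of integer
  cells that is addressed by computed indices; a scalar variable is a bank of which only cell 0 is
  used. Every integer that is read, used as an address, or produced by an operation is charged with
  its number of binary digits. With this cost measure, running times agree with those of multitape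
  Turing machines up to a polynomial.
\<close>

type_synonym store = "string \<Rightarrow> int \<Rightarrow> int"

datatype exp =
    Const int
  | Read string exp
  | Plus exp exp
  | Minus exp exp
  | Times exp exp

datatype com =
    Skip
  | Write string exp exp
  | Seq com com
  | IfPos exp com com
  | WhilePos exp com

definition width :: "int \<Rightarrow> nat" where
  "width k = 1 + floorlog 2 (nat \<bar>k\<bar>)"

fun val :: "exp \<Rightarrow> store \<Rightarrow> int" where
  "val (Const k) s = k"
| "val (Read x a) s = s x (val a s)"
| "val (Plus a b) s = val a s + val b s"
| "val (Minus a b) s = val a s - val b s"
| "val (Times a b) s = val a s * val b s"

fun cost :: "exp \<Rightarrow> store \<Rightarrow> nat" where
  "cost (Const k) s = width k"
| "cost (Read x a) s = cost a s + width (val (Read x a) s)"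
| "cost (Plus a b) s = cost a s + cost b s + width (val (Plus a b) s)"
| "cost (Minus a b) s = cost a s + cost b s + width (val (Minus a b) s)"
| "cost (Times a b) s = cost a s + cost b s + width (val (Times a b) s)"

text \<open>\<open>exec c s t s'\<close>: started in store \<open>s\<close>, program \<open>c\<close> halts in store \<open>s'\<close> after time \<open>t\<close>.\<close>

inductive exec :: "com \<Rightarrow> store \<Rightarrow> nat \<Rightarrow> store \<Rightarrow> bool" where
  Skip: "exec Skip s 1 s"
| Write: "exec (Write x a b) s (1 + cost a s + cost b s) (s(x := (s x)(val a s := val b s)))"
| Seq: "exec c1 s1 t1 s2 \<Longrightarrow> exec c2 s2 t2 s3 \<Longrightarrow> exec (Seq c1 c2) s1 (t1 + t2) s3"
| IfTrue: "val b s > 0 \<Longrightarrow> exec c1 s t s' \<Longrightarrow> exec (IfPos b c1 c2) s (1 + cost b s + t) s'"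
| IfFalse: "\<not> val b s > 0 \<Longrightarrow> exec c2 s t s' \<Longrightarrow> exec (IfPos b c1 c2) s (1 + cost b s + t) s'"
| WhileFalse: "\<not> val b s > 0 \<Longrightarrow> exec (WhilePos b c) s (1 + cost b s) s"
| WhileTrue: "val b s1 > 0 \<Longrightarrow> exec c s1 t1 s2 \<Longrightarrow> exec (WhilePos b c) s2 t2 s3 \<Longrightarrow>
    exec (WhilePos b c) s1 (1 + cost b s1 + t1 + t2) s3"

text \<open>
  A list of integers is input (output) through the bank \<open>in\<close> (\<open>out\<close>): cell 0 holds its length and
  the cells from 1 on hold its entries. All other cells are initially 0.
\<close>

definition input_store :: "int list \<Rightarrow> store" where
  "input_store xs = (\<lambda>x i.
     if x = ''in'' \<and> i = 0 then int (length xs)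
     else if x = ''in'' \<and> 1 \<le> i \<and> i \<le> int (length xs) then xs ! nat (i - 1)
     else 0)"

definition output_list :: "store \<Rightarrow> int list" where
  "output_list s = map (s ''out'') [1..s ''out'' 0]"

definition input_size :: "int list \<Rightarrow> nat" where
  "input_size xs = (\<Sum>x\<leftarrow>xs. width x)"

text \<open>
  \<open>polytime_solves c I code R\<close>: on the code of every instance \<open>x \<in> I\<close>, program \<open>c\<close> halts in
  polynomial time with an output \<open>ys\<close> that is correct for \<open>x\<close>, i.e. \<open>R x ys\<close>. Nothing is required
  of \<open>c\<close> on other inputs.
\<close>

definition polytime_solves ::
    "com \<Rightarrow> 'i set \<Rightarrow> ('i \<Rightarrow> int list) \<Rightarrow> ('i \<Rightarrow> int list \<Rightarrow> bool) \<Rightarrow> bool" where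
  "polytime_solves c I code R \<longleftrightarrow>
     (\<exists>p :: nat poly. \<forall>x\<in>I. \<exists>t s.
        exec c (input_store (code x)) t s \<and> t \<le> poly p (input_size (code x)) \<and> R x (output_list s))"


section \<open>Encoding of the instances\<close>

text \<open>
  A digraph is presented by arbitrary enumerations \<open>vs\<close> of its vertices and \<open>es\<close> of its arcs.
\<close>

definition enumerates :: "'c list \<Rightarrow> 'c set \<Rightarrow> bool" where
  "enumerates xs A \<longleftrightarrow> distinct xs \<and> set xs = A"

definition position :: "'c list \<Rightarrow> 'c \<Rightarrow> int" where
  "position xs x = int (length (takeWhile (\<lambda>y. y \<noteq> x) xs))"

text \<open>
  The code of a digraph consists of the numbers of vertices and arcs, the list of the vertices and
  the list of the (tail, head) pairs of the arcs, each vertex being represented by its position in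
  \<open>vs\<close>. Listing the vertices makes the input size at least the number of vertices, also in the
  presence of isolated vertices.
\<close>

definition digraph_code :: "('a, 'b) pre_digraph \<Rightarrow> 'a list \<Rightarrow> 'b list \<Rightarrow> int list" where
  "digraph_code G vs es =
     [int (length vs), int (length es)] @ map (position vs) vs @
     concat (map (\<lambda>e. [position vs (tail G e), position vs (head G e)]) es)"

text \<open>
  Functions on the arcs that are read or written by an algorithm are rational valued; each value
  is represented by the numerator and the (positive) denominator of its reduced fraction.
\<close>

definition function_code :: "'b list \<Rightarrow> ('b \<Rightarrow> rat) \<Rightarrow> int list" where
  "function_code es f =
     concat (map (\<lambda>e. [fst (quotient_of (f e)), snd (quotient_of (f e))]) es)"

end

theory Submission
  imports Defs
begin

text \<open>
  Fix a weighting \<open>w\<close> of \<open>G\<close>. A closed walk decomposes into dicycles, so its weight is the number of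
  dicycles removed by loop erasure, and this number can be computed without knowing \<open>w\<close>. Choose for
  all vertices a walk from the one to the other, if there is any. Within the strong component of a
  vertex \<open>r\<close>, the weight of \<open>r \<rightarrow> u \<rightarrow> v \<rightarrow> r\<close> via an arc \<open>e = (u, v)\<close> minus the weight of
  \<open>r \<rightarrow> v \<rightarrow> r\<close> is \<open>w e + \<phi> u - \<phi> v\<close>, where \<open>\<phi> x\<close> is the weight of the chosen walk from \<open>r\<close> to \<open>x\<close>.
  These computable integers have the same sum as \<open>w\<close> on all dicycles and form a weighting. Similarly
  a function \<open>f\<close> is a weighting iff it agrees with the number of dicycles in all these differences.
\<close>

section \<open>For-programs\<close>

text \<open>The unknown weighting \<open>w\<close> enters only the analysis. The machine erases
  loops and counts in integers, and an erased dicycle weighs 1 whatever \<open>w\<close> is;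
  comparing two closed walks with the same return to r leaves \<open>w e\<close> up to a potential
  difference, which dicycle sums forget. So the possibly exponentially many dicycles need not be
  inspected. Since every weighting explains the same integers, a run of the test can be analysed
  with \<open>f\<close> itself whenever \<open>f\<close> is a weighting. Rational values are handled
  by counting with a common denominator \<open>d\<close> and integers \<open>g = d f\<close>. Strong
  components are not computed: every vertex serves as r, and its pass treats all arcs of a dicycle
  or none. On the machine side, logarithmic cost requires bit bounds for all intermediate numbers;
  they are read off the syntax of a language with bounded loops.\<close>

datatype prog =
    Halt
  | Assign string exp exp
  | Then prog prog (infixr \<open>;;\<close> 60)
  | Cond exp prog prog
  | For string int prog

fun compile :: "prog \<Rightarrow> com" where
  "compile Halt = Skip"
| "compile (Assign x a b) = Write x a b"
| "compile (c ;; d) = Seq (compile c) (compile d)"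
| "compile (Cond b c d) = IfPos b (compile c) (compile d)"
| "compile (For i k c) = Seq (Write i (Const 0) (Const 0))
     (WhilePos (Minus (Read ''in'' (Const k)) (Read i (Const 0)))
       (Seq (compile c) (Write i (Const 0) (Plus (Read i (Const 0)) (Const 1)))))"

definition upd :: "string \<Rightarrow> int \<Rightarrow> int \<Rightarrow> store \<Rightarrow> store" where
  "upd x a v s = s(x := (s x)(a := v))"

text \<open>The number of rounds is fixed on entry to a loop, whereas the compiled guard rereads the
  input cell and the counter each time. The two agree for \<open>tame\<close> programs, whose loop
  bodies write neither.\<close>

fun run :: "prog \<Rightarrow> store \<Rightarrow> store" where
  "run Halt s = s"
| "run (Assign x a b) s = upd x (val a s) (val b s) s"
| "run (c ;; d) s = run d (run c s)"
| "run (Cond b c d) s = (if val b s > 0 then run c s else run d s)"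
| "run (For i k c) s =
     ((\<lambda>s. upd i 0 (run c s i 0 + 1) (run c s)) ^^ nat (s ''in'' k)) (upd i 0 0 s)"

fun writes :: "prog \<Rightarrow> string set" where
  "writes Halt = {}"
| "writes (Assign x a b) = {x}"
| "writes (c ;; d) = writes c \<union> writes d"
| "writes (Cond b c d) = writes c \<union> writes d"
| "writes (For i k c) = insert i (writes c)"

text \<open>
  A factor of every product is an input cell. Hence a unit step adds only linearly many bits to
  the numbers in the store, and no repeated squaring can occur.
\<close>

fun tame_exp :: "exp \<Rightarrow> bool" where
  "tame_exp (Const k) = True"
| "tame_exp (Read x a) = tame_exp a"
| "tame_exp (Plus a b) = (tame_exp a \<and> tame_exp b)"
| "tame_exp (Minus a b) = (tame_exp a \<and> tame_exp b)"
| "tame_exp (Times a b) = (tame_exp a \<and> tame_exp b \<and> (\<exists>c. b = Read ''in'' c))"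

text \<open>Loops may only run up to the cells 1 and 2 of \<open>in\<close>, the numbers of vertices
  and arcs. Other entries, such as numerators, can be exponential in the input size.\<close>

fun tame :: "prog \<Rightarrow> bool" where
  "tame Halt = True"
| "tame (Assign x a b) = (tame_exp a \<and> tame_exp b \<and> x \<noteq> ''in'')"
| "tame (c ;; d) = (tame c \<and> tame d)"
| "tame (Cond b c d) = (tame_exp b \<and> tame c \<and> tame d)"
| "tame (For i k c) = (tame c \<and> i \<noteq> ''in'' \<and> i \<notin> writes c \<and> (k = 1 \<or> k = 2))"

lemma upd_other [simp]: "y \<noteq> x \<Longrightarrow> upd x a v s y = s y"
  by (simp add: upd_def)

lemma upd_same: "upd x a v s x b = (if b = a then v else s x b)"
  by (simp add: upd_def)

lemma run_frame: "x \<notin> writes c \<Longrightarrow> run c s x = s x"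
proof (induction c arbitrary: s)
  case (For i k c)
  have "((\<lambda>s. upd i 0 (run c s i 0 + 1) (run c s)) ^^ N) s x = s x" for N s
    by (induction N) (use For in auto)
  then show ?case using For.prems by simp
qed auto

lemma tame_writes: "tame c \<Longrightarrow> ''in'' \<notin> writes c"
  by (induction c) auto

text \<open>The step premise supplies the counter value and all banks outside
  \<open>writes c\<close>, so that \<open>P\<close> has to speak only of the banks changed by the
  body. \<open>P\<close> is required after the counter has been advanced.\<close>

lemma run_For_invariant:
  assumes inv: "i \<notin> writes c" "i \<noteq> ''in''" and "''in'' \<notin> writes c"
    and N: "N = nat (s ''in'' k)"
    and init: "P 0 (upd i 0 0 s)"
    and step: "\<And>j s'. j < N \<Longrightarrow> s' i 0 = int j \<Longrightarrow>
      (\<And>x. x \<noteq> i \<Longrightarrow> x \<notin> writes c \<Longrightarrow> s' x = s x) \<Longrightarrow> P j s' \<Longrightarrow>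
      P (Suc j) (upd i 0 (int (Suc j)) (run c s'))"
  shows "P N (run (For i k c) s)"
proof -
  let ?f = "\<lambda>s. upd i 0 (run c s i 0 + 1) (run c s)"
  have "P j ((?f ^^ j) (upd i 0 0 s)) \<and> (?f ^^ j) (upd i 0 0 s) i 0 = int j \<and>
      (\<forall>x. x \<noteq> i \<longrightarrow> x \<notin> writes c \<longrightarrow> (?f ^^ j) (upd i 0 0 s) x = s x)" if "j \<le> N" for j
    using that
  proof (induction j)
    case 0
    then show ?case using init by (simp add: upd_same)
  next
    case (Suc j)
    let ?s = "(?f ^^ j) (upd i 0 0 s)"
    have IH: "P j ?s" "?s i 0 = int j" "\<And>x. x \<noteq> i \<Longrightarrow> x \<notin> writes c \<Longrightarrow> ?s x = s x"
      using Suc by auto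
    have i: "run c ?s i 0 = int j" using IH(2) run_frame[OF inv(1)] by simp
    have eq: "(?f ^^ Suc j) (upd i 0 0 s) = upd i 0 (int (Suc j)) (run c ?s)"
      using i by (simp add: add.commute)
    have "P (Suc j) (upd i 0 (int (Suc j)) (run c ?s))"
      using step[of j ?s] Suc.prems IH by simp
    then show ?case unfolding eq using IH(3) by (auto simp: upd_same run_frame)
  qed
  from this[of N] show ?thesis using N by simp
qed

subsection \<open>Running times\<close>

definition bounded :: "nat \<Rightarrow> store \<Rightarrow> bool" where
  "bounded S s \<longleftrightarrow> (\<forall>x i. \<bar>s x i\<bar> < 2 ^ S)"

text \<open>The input is never written, so its bit bound \<open>X\<close> stays fixed while the
  bound \<open>S\<close> of the whole store grows. The cells 1 and 2 are bounded by value because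
  they are loop counts.\<close>

definition in_bounded :: "nat \<Rightarrow> store \<Rightarrow> bool" where
  "in_bounded X s \<longleftrightarrow> (\<forall>i. \<bar>s ''in'' i\<bar> < 2 ^ X) \<and> nat (s ''in'' 1) \<le> X \<and> nat (s ''in'' 2) \<le> X"

fun esize :: "exp \<Rightarrow> nat" where
  "esize (Const k) = nat \<bar>k\<bar> + 1"
| "esize (Read x a) = 1 + esize a"
| "esize (Plus a b) = 1 + esize a + esize b"
| "esize (Minus a b) = 1 + esize a + esize b"
| "esize (Times a b) = 1 + esize a + esize b"

lemma bounded_mono: "bounded S s \<Longrightarrow> S \<le> S' \<Longrightarrow> bounded S' s"
  unfolding bounded_def by (meson less_le_trans one_le_numeral power_increasing)

lemma width_le:
  assumes "\<bar>k\<bar> < 2 ^ S" shows "width k \<le> 1 + S"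
proof -
  have "nat \<bar>k\<bar> < 2 ^ S" using assms by (simp add: nat_less_iff)
  then show ?thesis unfolding width_def by (simp add: floorlog_le_iff)
qed

lemma less_power_width: "\<bar>k\<bar> < 2 ^ width k"
proof -
  have "nat \<bar>k\<bar> < 2 ^ floorlog 2 (nat \<bar>k\<bar>)"
    by (metis floorlog_bounds floorlog_eq_zero_iff gr0I less_numeral_extra(1) nat_1_add_1
        one_less_numeral_iff power_0 semiring_norm(76) zero_less_power zero_neq_numeral)
  also have "\<dots> \<le> 2 ^ width k" by (rule power_increasing) (auto simp: width_def)
  finally show ?thesis by (simp add: nat_less_iff)
qed

lemma abs_add_less_power:
  fixes a b :: int
  assumes "\<bar>a\<bar> < 2 ^ p" "\<bar>b\<bar> < 2 ^ q" "p < r" "q < r"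
  shows "\<bar>a + b\<bar> < 2 ^ r" "\<bar>a - b\<bar> < 2 ^ r"
proof -
  obtain r' where r: "r = Suc r'" using assms by (cases r) auto
  have "(2::int) ^ p \<le> 2 ^ r'" "(2::int) ^ q \<le> 2 ^ r'"
    using assms r by (auto intro: power_increasing)
  then have "\<bar>a\<bar> < 2 ^ r'" "\<bar>b\<bar> < 2 ^ r'" using assms(1,2) by linarith+
  moreover have "(2::int) ^ r = 2 * 2 ^ r'" using r by simp
  ultimately show "\<bar>a + b\<bar> < 2 ^ r" "\<bar>a - b\<bar> < 2 ^ r" by linarith+
qed

text \<open>Growth is additive: a sum or difference gains one bit, a product at most
  \<open>X\<close> bits since its right factor is an input cell. Each unit of \<open>esize\<close>
  is granted \<open>X + 1\<close> bits.\<close>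

lemma val_bound:
  assumes "tame_exp e" "bounded S s" "in_bounded X s"
  shows "\<bar>val e s\<bar> < 2 ^ (S + esize e * (X + 1))"
  using assms(1)
proof (induction e)
  case (Const k)
  have "nat \<bar>k\<bar> < 2 ^ nat \<bar>k\<bar>" by simp
  then have "\<bar>k\<bar> < 2 ^ nat \<bar>k\<bar>" by (metis abs_ge_zero nat_less_iff of_nat_numeral of_nat_power)
  also have "\<dots> \<le> 2 ^ (S + esize (Const k) * (X + 1))" by (rule power_increasing) auto
  finally show ?case by simp
next
  case (Read x a)
  have "\<bar>val (Read x a) s\<bar> < 2 ^ S" using assms(2) by (simp add: bounded_def)
  also have "\<dots> \<le> 2 ^ (S + esize (Read x a) * (X + 1))" by (rule power_increasing) auto
  finally show ?case .
next
  case (Plus a b)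
  then have "\<bar>val a s + val b s\<bar> < 2 ^ (S + esize (Plus a b) * (X + 1))"
    by (intro abs_add_less_power(1)[of _ "S + esize a * (X+1)" _ "S + esize b * (X+1)"]) (auto simp: algebra_simps)
  then show ?case by simp
next
  case (Minus a b)
  then have "\<bar>val a s - val b s\<bar> < 2 ^ (S + esize (Minus a b) * (X + 1))"
    by (intro abs_add_less_power(2)[of _ "S + esize a * (X+1)" _ "S + esize b * (X+1)"]) (auto simp: algebra_simps)
  then show ?case by simp
next
  case (Times a b)
  then obtain c where c: "b = Read ''in'' c" by auto
  have "\<bar>val b s\<bar> < 2 ^ X" using assms(3) c by (simp add: in_bounded_def)
  moreover have "\<bar>val a s\<bar> < 2 ^ (S + esize a * (X+1))" using Times by simp
  ultimately have "\<bar>val a s\<bar> * \<bar>val b s\<bar> < 2 ^ (S + esize a * (X+1)) * 2 ^ X"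
    by (intro mult_strict_mono) auto
  also have "\<dots> = 2 ^ (S + esize a * (X+1) + X)" by (simp add: power_add)
  also have "\<dots> \<le> 2 ^ (S + esize (Times a b) * (X + 1))"
    by (rule power_increasing) (auto simp: algebra_simps)
  finally show ?case by (simp add: abs_mult)
qed

text \<open>\<open>E\<close> stays fixed in the induction, so every node is charged the same width
  and the total is linear in \<open>esize e\<close>.\<close>

lemma cost_bound:
  assumes "tame_exp e" "bounded S s" "in_bounded X s" "esize e \<le> E"
  shows "cost e s \<le> esize e * (1 + S + E * (X + 1))"
  using assms(1,4)
proof (induction e)
  have w: "width (val e s) \<le> 1 + S + E * (X + 1)" if "tame_exp e" "esize e \<le> E" for e
  proof -
    have "width (val e s) \<le> 1 + (S + esize e * (X + 1))"
      by (rule width_le) (rule val_bound[OF that(1) assms(2,3)])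
    also have "\<dots> \<le> 1 + S + E * (X + 1)"
      using mult_le_mono1[OF that(2), of "X + 1"] by linarith
    finally show ?thesis .
  qed
  {
    case (Const k)
    have "cost (Const k) s \<le> 1 * (1 + S + E * (X + 1))" using w[OF Const] by simp
    also have "\<dots> \<le> esize (Const k) * (1 + S + E * (X + 1))" by (rule mult_le_mono1) simp
    finally show ?case .
  next
    case (Read x a)
    then show ?case using w[of "Read x a"] by (simp add: algebra_simps)
  next
    case (Plus a b)
    then show ?case using w[of "Plus a b"] by (simp add: algebra_simps)
  next
    case (Minus a b)
    then show ?case using w[of "Minus a b"] by (simp add: algebra_simps)
  next
    case (Times a b)
    then show ?case using w[of "Times a b"] by (simp add: algebra_simps)
  }
qed

text \<open>
  On inputs of size \<open>X\<close>, \<open>growth\<close> bounds the number of bits that a run adds to the numbers in the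
  store, and \<open>steps\<close> the number of unit steps. Loop counts are input cells bounded by \<open>X\<close>.
\<close>

fun growth :: "prog \<Rightarrow> nat poly" where
  "growth Halt = 0"
| "growth (Assign x a b) = of_nat (esize a + esize b) * [:1, 1:]"
| "growth (c ;; d) = growth c + growth d"
| "growth (Cond b c d) = of_nat (esize b) * [:1, 1:] + growth c + growth d"
| "growth (For i k c) = 20 * [:1, 1:] + [:0, 1:] * (growth c + 20 * [:1, 1:])"

fun steps :: "prog \<Rightarrow> nat poly" where
  "steps Halt = 1"
| "steps (Assign x a b) = 1 + of_nat (esize a + esize b)"
| "steps (c ;; d) = steps c + steps d"
| "steps (Cond b c d) = 1 + of_nat (esize b) + steps c + steps d"
| "steps (For i k c) = 20 + [:0, 1:] * (steps c + 20)"

lemma bounded_upd: "bounded S s \<Longrightarrow> \<bar>v\<bar> < 2 ^ S \<Longrightarrow> bounded S (upd x a v s)"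
  by (simp add: bounded_def upd_def)

lemma in_bounded_cong: "in_bounded X s \<Longrightarrow> s' ''in'' = s ''in'' \<Longrightarrow> in_bounded X s'"
  unfolding in_bounded_def by metis

lemma exec_Write_bound:
  assumes "tame_exp a" "tame_exp b" "bounded S s" "in_bounded X s"
  defines "E \<equiv> esize a + esize b"
  shows "\<exists>t. exec (Write x a b) s t (upd x (val a s) (val b s) s) \<and>
      t \<le> (1 + E) * (1 + S + E * (X + 1)) \<and>
      bounded (S + E * (X + 1)) (upd x (val a s) (val b s) s)"
proof (intro exI conjI)
  show "exec (Write x a b) s (1 + cost a s + cost b s) (upd x (val a s) (val b s) s)"
    unfolding upd_def by (rule exec.Write)
  have "cost a s \<le> esize a * (1 + S + E * (X + 1))" "cost b s \<le> esize b * (1 + S + E * (X + 1))"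
    unfolding E_def by (intro cost_bound assms(1-4); simp)+
  then show "1 + cost a s + cost b s \<le> (1 + E) * (1 + S + E * (X + 1))"
    by (simp add: E_def add_mult_distrib)
  have "\<bar>val b s\<bar> < 2 ^ (S + esize b * (X + 1))" by (rule val_bound[OF assms(2-4)])
  also have "\<dots> \<le> 2 ^ (S + E * (X + 1))"
    by (rule power_increasing) (auto simp: E_def add_mult_distrib)
  finally show "bounded (S + E * (X + 1)) (upd x (val a s) (val b s) s)"
    by (intro bounded_upd bounded_mono[OF assms(3)]) auto
qed

text \<open>Induction on the number \<open>r\<close> of rounds left, from an arbitrary counter
  value. A round adds at most \<open>W\<close> bits, and all steps are charged the width allowed at
  the end of the loop. The guard has size at most 7 and the counter update size 6; the constants 10
  and 20 are generous roundings.\<close>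

lemma exec_loop_bound:
  fixes c i k and X :: nat
  defines "f \<equiv> \<lambda>s. upd i 0 (run c s i 0 + 1) (run c s)"
    and "W \<equiv> poly (growth c) X + 20 * (X + 1)"
  assumes c: "tame (For i k c)"
    and body: "\<And>s S. bounded S s \<Longrightarrow> in_bounded X s \<Longrightarrow>
      \<exists>t. exec (compile c) s t (run c s) \<and> t \<le> poly (steps c) X * (1 + S + poly (growth c) X) \<and>
        bounded (S + poly (growth c) X) (run c s)"
  shows "bounded S s \<Longrightarrow> in_bounded X s \<Longrightarrow> r = nat (s ''in'' k - s i 0) \<Longrightarrow>
    \<exists>t. exec (WhilePos (Minus (Read ''in'' (Const k)) (Read i (Const 0)))
       (Seq (compile c) (Write i (Const 0) (Plus (Read i (Const 0)) (Const 1))))) s t ((f ^^ r) s) \<and>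
      t \<le> (r * (poly (steps c) X + 20) + 10) * (1 + S + r * W + 20 * (X + 1)) \<and>
      bounded (S + r * W) ((f ^^ r) s)"
proof (induction r arbitrary: s S)
  case 0
  let ?b = "Minus (Read ''in'' (Const k)) (Read i (Const 0))"
  have b: "tame_exp ?b" "esize ?b \<le> 7" using c by auto
  have "cost ?b s \<le> esize ?b * (1 + S + 7 * (X + 1))"
    by (rule cost_bound[OF b(1) 0(1,2) b(2)])
  also have "\<dots> \<le> 7 * (1 + S + 20 * (X + 1))" by (rule mult_le_mono[OF b(2)]) simp
  finally have "1 + cost ?b s \<le> 10 * (1 + S + 20 * (X + 1))" by simp
  moreover have "\<not> 0 < val ?b s" using 0(3) by simp
  ultimately show ?case using 0 exec.WhileFalse[of ?b s] by (intro exI conjI) auto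
next
  case (Suc r)
  let ?b = "Minus (Read ''in'' (Const k)) (Read i (Const 0))"
  let ?e = "Plus (Read i (Const 0)) (Const 1)"
  define B where "B = 1 + S + Suc r * W + 20 * (X + 1)"
  have b: "tame_exp ?b" "esize ?b \<le> 7" using c by auto
  have "cost ?b s \<le> esize ?b * (1 + S + 7 * (X + 1))"
    by (rule cost_bound[OF b(1) Suc.prems(1,2) b(2)])
  also have "\<dots> \<le> 7 * B" unfolding B_def by (rule mult_le_mono[OF b(2)]) simp
  finally have t0: "cost ?b s \<le> 7 * B" .
  obtain t1 where t1: "exec (compile c) s t1 (run c s)"
    "t1 \<le> poly (steps c) X * (1 + S + poly (growth c) X)"
    "bounded (S + poly (growth c) X) (run c s)"
    using body[OF Suc.prems(1,2)] by blast
  have in_eq: "run c s ''in'' = s ''in''" using c by (simp add: run_frame tame_writes)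
  have i_eq: "run c s i = s i" using c by (auto intro: run_frame)
  have in1: "in_bounded X (run c s)" using in_bounded_cong Suc.prems(2) in_eq by blast
  have "poly (steps c) X * (1 + S + poly (growth c) X) \<le> poly (steps c) X * B"
    unfolding B_def W_def by (rule mult_le_mono) auto
  then have t1': "t1 \<le> poly (steps c) X * B" using t1(2) by linarith
  have fs: "upd i (val (Const 0) (run c s)) (val ?e (run c s)) (run c s) = f s"
    by (simp add: f_def)
  have e6: "esize (Const 0) + esize ?e = 6" by simp
  obtain t2 where t2: "exec (Write i (Const 0) ?e) (run c s) t2 (f s)"
    "t2 \<le> (1 + 6) * (1 + (S + poly (growth c) X) + 6 * (X + 1))"
    "bounded (S + poly (growth c) X + 6 * (X + 1)) (f s)"
    using exec_Write_bound[OF _ _ t1(3) in1, of "Const 0" ?e i, unfolded fs e6] by fastforce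
  have "t2 \<le> 7 * (1 + (S + poly (growth c) X) + 6 * (X + 1))" using t2(2) by simp
  also have "\<dots> \<le> 7 * B" unfolding B_def W_def by (rule mult_le_mono) auto
  finally have t2': "t2 \<le> 7 * B" .
  have bd: "bounded (S + W) (f s)" by (rule bounded_mono[OF t2(3)]) (simp add: W_def)
  have "''in'' \<noteq> i" using c by auto
  then have f_in: "f s ''in'' = s ''in''" using in_eq by (simp add: f_def)
  have f_i: "f s i 0 = s i 0 + 1" using i_eq by (simp add: f_def upd_same)
  have r: "r = nat (f s ''in'' k - f s i 0)" using Suc.prems(3) f_in f_i by simp
  obtain t3 where t3: "exec (WhilePos ?b (Seq (compile c) (Write i (Const 0) ?e))) (f s) t3 ((f ^^ r) (f s))"
    "t3 \<le> (r * (poly (steps c) X + 20) + 10) * (1 + (S + W) + r * W + 20 * (X + 1))"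
    "bounded (S + W + r * W) ((f ^^ r) (f s))"
    using Suc.IH[OF bd _ r] in_bounded_cong Suc.prems(2) f_in by blast
  have "1 + (S + W) + r * W + 20 * (X + 1) = B" by (simp add: B_def)
  then have t3': "t3 \<le> (r * (poly (steps c) X + 20) + 10) * B" using t3(2) by simp
  have ex: "exec (WhilePos ?b (Seq (compile c) (Write i (Const 0) ?e))) s
      (1 + cost ?b s + (t1 + t2) + t3) ((f ^^ r) (f s))"
    using Suc.prems(3) by (intro exec.WhileTrue[OF _ exec.Seq[OF t1(1) t2(1)] t3(1)]) auto
  have "1 \<le> B" by (simp add: B_def)
  then have "1 + cost ?b s + (t1 + t2) + t3 \<le> (Suc r * (poly (steps c) X + 20) + 10) * B"
    using t0 t1' t2' t3' by (simp add: algebra_simps)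
  moreover have "(f ^^ Suc r) s = (f ^^ r) (f s)" by (simp add: funpow_swap1)
  moreover have "S + Suc r * W = S + W + r * W" by simp
  ultimately show ?case using ex t3(3) unfolding B_def by metis
qed

text \<open>Time is bounded by unit steps times final width. Both stay polynomial in
  \<open>X\<close>: they add up under sequencing, and a loop contributes a factor
  \<open>X\<close>.\<close>

lemma exec_compile:
  assumes "tame c" "bounded S s" "in_bounded X s"
  shows "\<exists>t. exec (compile c) s t (run c s) \<and>
    t \<le> poly (steps c) X * (1 + S + poly (growth c) X) \<and> bounded (S + poly (growth c) X) (run c s)"
  using assms
proof (induction c arbitrary: s S)
  case Halt
  then show ?case using exec.Skip by fastforce
next
  case (Assign x a b)
  then show ?case using exec_Write_bound[of a b S s X x] by (simp add: algebra_simps)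
next
  case (Then c d)
  define g where "g = poly (growth c) X + poly (growth d) X"
  obtain t1 where t1: "exec (compile c) s t1 (run c s)"
    "t1 \<le> poly (steps c) X * (1 + S + poly (growth c) X)"
    "bounded (S + poly (growth c) X) (run c s)"
    using Then.IH(1)[of S s] Then.prems by auto
  have "run c s ''in'' = s ''in''" using Then.prems by (simp add: run_frame tame_writes)
  then obtain t2 where t2: "exec (compile d) (run c s) t2 (run d (run c s))"
    "t2 \<le> poly (steps d) X * (1 + (S + poly (growth c) X) + poly (growth d) X)"
    "bounded (S + poly (growth c) X + poly (growth d) X) (run d (run c s))"
    using Then.IH(2)[OF _ t1(3)] in_bounded_cong Then.prems by fastforce
  have "t1 \<le> poly (steps c) X * (1 + S + g)"
    by (rule order.trans[OF t1(2)]) (auto simp: g_def intro!: mult_le_mono)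
  moreover have "t2 \<le> poly (steps d) X * (1 + S + g)"
    using t2(2) by (simp add: g_def add.assoc)
  ultimately have "t1 + t2 \<le> (poly (steps c) X + poly (steps d) X) * (1 + S + g)"
    by (simp add: add_mult_distrib)
  then show ?case using exec.Seq[OF t1(1) t2(1)] t2(3)
    by (intro exI[of _ "t1 + t2"]) (auto simp: g_def add.assoc)
next
  case (Cond b c d)
  define g where "g = esize b * (X + 1) + poly (growth c) X + poly (growth d) X"
  have "cost b s \<le> esize b * (1 + S + esize b * (X + 1))"
    using Cond.prems by (intro cost_bound) auto
  also have "\<dots> \<le> esize b * (1 + S + g)" by (rule mult_le_mono2) (simp add: g_def)
  finally have cb: "cost b s \<le> esize b * (1 + S + g)" .
  have "\<exists>t. exec (compile (Cond b c d)) s t (run (Cond b c d) s) \<and>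
      t \<le> 1 + cost b s + (poly (steps c) X + poly (steps d) X) * (1 + S + g) \<and>
      bounded (S + g) (run (Cond b c d) s)"
  proof (cases "val b s > 0")
    case True
    obtain t where t: "exec (compile c) s t (run c s)"
      "t \<le> poly (steps c) X * (1 + S + poly (growth c) X)"
      "bounded (S + poly (growth c) X) (run c s)"
      using Cond.IH(1)[of S s] Cond.prems by auto
    have "t \<le> (poly (steps c) X + poly (steps d) X) * (1 + S + g)"
      by (rule order.trans[OF t(2)], rule mult_le_mono) (auto simp: g_def)
    moreover have "bounded (S + g) (run c s)" by (rule bounded_mono[OF t(3)]) (simp add: g_def)
    ultimately show ?thesis using exec.IfTrue[OF True t(1), of "compile d"] True by fastforce
  next
    case False
    obtain t where t: "exec (compile d) s t (run d s)"
      "t \<le> poly (steps d) X * (1 + S + poly (growth d) X)"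
      "bounded (S + poly (growth d) X) (run d s)"
      using Cond.IH(2)[of S s] Cond.prems by auto
    have "t \<le> (poly (steps c) X + poly (steps d) X) * (1 + S + g)"
      by (rule order.trans[OF t(2)], rule mult_le_mono) (auto simp: g_def)
    moreover have "bounded (S + g) (run d s)" by (rule bounded_mono[OF t(3)]) (simp add: g_def)
    ultimately show ?thesis using exec.IfFalse[OF False t(1), of "compile c"] False by fastforce
  qed
  then obtain t where t: "exec (compile (Cond b c d)) s t (run (Cond b c d) s)"
      "t \<le> 1 + cost b s + (poly (steps c) X + poly (steps d) X) * (1 + S + g)"
      "bounded (S + g) (run (Cond b c d) s)" by blast
  have "t \<le> (1 + esize b + poly (steps c) X + poly (steps d) X) * (1 + S + g)"
    using t(2) cb by (simp add: algebra_simps)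
  moreover have "poly (steps (Cond b c d)) X = 1 + esize b + poly (steps c) X + poly (steps d) X"
    "poly (growth (Cond b c d)) X = g" by (simp_all add: g_def)
  ultimately show ?case using t by metis
next
  case (For i k c)
  let ?W = "poly (growth c) X + 20 * (X + 1)"
  let ?N = "nat (s ''in'' k)"
  define B where "B = 1 + S + (20 * (X + 1) + X * ?W)"
  have N: "?N \<le> X" using For.prems by (auto simp: in_bounded_def)
  have W0: "exec (Write i (Const 0) (Const 0)) s (1 + width 0 + width 0) (upd i 0 0 s)"
    using exec.Write[of i "Const 0" "Const 0" s] by (simp add: upd_def)
  have in0: "upd i 0 0 s ''in'' = s ''in''" using For.prems by (intro upd_other) auto
  have bd0: "bounded S (upd i 0 0 s)" using For.prems by (intro bounded_upd) auto
  have ib0: "in_bounded X (upd i 0 0 s)" using in_bounded_cong For.prems(3) in0 by blast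
  have N0: "?N = nat (upd i 0 0 s ''in'' k - upd i 0 0 s i 0)" using in0 by (simp add: upd_same)
  have tame: "tame c" using For.prems by simp
  obtain t where t: "exec (WhilePos (Minus (Read ''in'' (Const k)) (Read i (Const 0)))
       (Seq (compile c) (Write i (Const 0) (Plus (Read i (Const 0)) (Const 1))))) (upd i 0 0 s) t
       (run (For i k c) s)"
    "t \<le> (?N * (poly (steps c) X + 20) + 10) * (1 + S + ?N * ?W + 20 * (X + 1))"
    "bounded (S + ?N * ?W) (run (For i k c) s)"
    using exec_loop_bound[OF For.prems(1) For.IH[OF tame] bd0 ib0 N0] unfolding run.simps by blast
  have NW: "?N * ?W \<le> X * ?W" by (rule mult_le_mono1[OF N])
  have "t \<le> (X * (poly (steps c) X + 20) + 10) * B"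
    using NW N by (intro order.trans[OF t(2)] mult_le_mono add_mono) (auto simp: B_def)
  moreover have "width 0 \<le> 1 + 0" by (rule width_le) simp
  moreover have "1 \<le> B" by (simp add: B_def)
  ultimately have "(1 + width 0 + width 0) + t \<le> (20 + X * (poly (steps c) X + 20)) * B"
    by (simp add: algebra_simps)
  moreover have "poly (steps (For i k c)) X = 20 + X * (poly (steps c) X + 20)" by simp
  moreover have g: "poly (growth (For i k c)) X = 20 * (X + 1) + X * ?W" by simp
  moreover have "bounded (S + poly (growth (For i k c)) X) (run (For i k c) s)"
    unfolding g by (rule bounded_mono[OF t(3)]) (use NW in linarith)
  moreover have "exec (compile (For i k c)) s ((1 + width 0 + width 0) + t) (run (For i k c) s)"
    using exec.Seq[OF W0 t(1)] by simp
  ultimately show ?case unfolding B_def by metis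
qed

lemma length_le_input_size: "length xs \<le> input_size xs"
  by (induction xs) (auto simp: input_size_def width_def)

text \<open>Initially every cell is bounded by 2 to the input size, so the bound is applied with
  \<open>S = X = input_size\<close>; the factor \<open>[:1, 1:] + growth c\<close> is
  \<open>1 + S + growth\<close>. Loop counts are at most the number of entries, each of which adds
  at least 1 to the input size.\<close>

lemma polytime_solves_compile:
  assumes c: "tame c"
    and size: "\<And>x k. x \<in> I \<Longrightarrow> k = 1 \<or> k = 2 \<Longrightarrow>
      nat (input_store (code x) ''in'' k) \<le> length (code x)"
    and correct: "\<And>x. x \<in> I \<Longrightarrow> R x (output_list (run c (input_store (code x))))"
  shows "polytime_solves (compile c) I code R"
proof -
  have width_sum: "width (xs ! i) \<le> input_size xs" if "i < length xs" for xs i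
    unfolding input_size_def using that by (intro member_le_sum_list) auto
  have bd: "bounded (input_size xs) (input_store xs)" for xs
    unfolding bounded_def
  proof (intro allI)
    fix x i
    have "\<bar>xs ! j\<bar> < 2 ^ input_size xs" if "j < length xs" for j
      by (rule less_le_trans[OF less_power_width power_increasing[OF width_sum[OF that]]]) simp
    moreover have "int (length xs) < 2 ^ input_size xs"
      using length_le_input_size[of xs] less_exp[of "input_size xs"]
      by (metis le_less_trans of_nat_less_iff of_nat_numeral of_nat_power)
    ultimately show "\<bar>input_store xs x i\<bar> < 2 ^ input_size xs"
      by (auto simp: input_store_def)
  qed
  have "\<exists>t s. exec (compile c) (input_store (code x)) t s \<and>
      t \<le> poly (steps c * ([:1, 1:] + growth c)) (input_size (code x)) \<and> R x (output_list s)"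
    if x: "x \<in> I" for x
  proof -
    have "in_bounded (input_size (code x)) (input_store (code x))"
      using bd[of "code x"] order.trans[OF size[OF x] length_le_input_size]
      by (auto simp: in_bounded_def bounded_def)
    from exec_compile[OF c bd this] correct[OF x] show ?thesis by fastforce
  qed
  then show ?thesis unfolding polytime_solves_def by blast
qed

section \<open>Digraphs on initial segments of the integers\<close>

locale index_digraph =
  fixes n m :: int and T H :: "int \<Rightarrow> int"
  assumes n_nonneg: "0 \<le> n" and m_nonneg: "0 \<le> m"
    and T_range: "\<And>e. 0 \<le> e \<Longrightarrow> e < m \<Longrightarrow> 0 \<le> T e \<and> T e < n"
    and H_range: "\<And>e. 0 \<le> e \<Longrightarrow> e < m \<Longrightarrow> 0 \<le> H e \<and> H e < n"
begin

fun walk :: "int \<Rightarrow> int list \<Rightarrow> int \<Rightarrow> bool" where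
  "walk x [] y \<longleftrightarrow> x = y"
| "walk x (e # p) y \<longleftrightarrow> 0 \<le> e \<and> e < m \<and> T e = x \<and> walk (H e) p y"

text \<open>Distinctness is asked of the heads because they form the vertex list of a walk without
  its first entry, which is what \<open>cycle\<close> constrains.\<close>

definition dicycle :: "int list \<Rightarrow> bool" where
  "dicycle p \<longleftrightarrow> p \<noteq> [] \<and> (\<exists>x. walk x p x) \<and> distinct (map H p)"

definition index_weighting :: "(int \<Rightarrow> real) \<Rightarrow> bool" where
  "index_weighting w \<longleftrightarrow> (\<forall>p. dicycle p \<longrightarrow> sum_list (map w p) = 1)"

abbreviation vert :: "int \<Rightarrow> bool" where
  "vert x \<equiv> 0 \<le> x \<and> x < n"

abbreviation arc :: "int \<Rightarrow> bool" where
  "arc e \<equiv> 0 \<le> e \<and> e < m"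

lemma walk_append: "walk x (p @ q) z \<longleftrightarrow> (\<exists>y. walk x p y \<and> walk y q z)"
  by (induction p arbitrary: x) auto

lemma walk_arcs: "walk x p y \<Longrightarrow> e \<in> set p \<Longrightarrow> arc e"
  by (induction p arbitrary: x) auto

lemma walk_last: "walk x p y \<Longrightarrow> y = last (x # map H p)"
  by (induction p arbitrary: x) auto

lemma walk_vert: "walk x p y \<Longrightarrow> p \<noteq> [] \<Longrightarrow> vert x \<and> vert y"
proof (induction p arbitrary: x)
  case (Cons e p)
  then show ?case using T_range H_range by (cases p) auto
qed simp

text \<open>Along a closed walk the potential terms cancel, so a shift by a potential changes no
  dicycle sum.\<close>

lemma walk_telescope:
  fixes h \<phi> :: "int \<Rightarrow> real"
  assumes "walk x p y"
  shows "(\<Sum>e\<leftarrow>p. h e + \<phi> (T e) - \<phi> (H e)) = sum_list (map h p) + \<phi> x - \<phi> y"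
  using assms by (induction p arbitrary: x) auto

lemma walk_take: "walk x p y \<Longrightarrow> i \<le> length p \<Longrightarrow> walk x (take i p) ((x # map H p) ! i)"
proof (induction p arbitrary: x i)
  case (Cons e p)
  then show ?case by (cases i) auto
qed simp

lemma walk_drop: "walk x p y \<Longrightarrow> i \<le> length p \<Longrightarrow> walk ((x # map H p) ! i) (drop i p) y"
proof (induction p arbitrary: x i)
  case (Cons e p)
  then show ?case by (cases i) auto
qed simp

lemma dicycle_arc: "dicycle p \<Longrightarrow> e \<in> set p \<Longrightarrow> arc e"
  unfolding dicycle_def using walk_arcs by blast

text \<open>Opening the cycle after \<open>e\<close> gives a closed walk at \<open>H e\<close>
  through all its arcs; the part before \<open>f\<close> is the desired walk.\<close>

lemma dicycle_walk_to:
  assumes "dicycle p" "e \<in> set p" "f \<in> set p"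
  obtains q where "walk (H e) q (T f)"
proof -
  obtain x where x: "walk x p x" using assms(1) by (auto simp: dicycle_def)
  obtain p1 p2 where p: "p = p1 @ e # p2" using assms(2) by (meson split_list)
  have "walk (H e) (p2 @ p1 @ [e]) (H e)" using x p by (auto simp: walk_append)
  moreover have "f \<in> set (p2 @ p1 @ [e])" using assms(3) p by auto
  then obtain q1 q2 where "p2 @ p1 @ [e] = q1 @ f # q2" by (meson split_list)
  ultimately have "walk (H e) q1 (T f)" by (auto simp: walk_append)
  then show ?thesis by (rule that)
qed

end

subsection \<open>Passing to indices\<close>

lemma position_nth:
  assumes "distinct xs" "i < length xs"
  shows "position xs (xs ! i) = int i"
proof -
  have "takeWhile (\<lambda>y. y \<noteq> xs ! i) xs = take i xs"
  proof (rule takeWhile_eq_take_P_nth)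
    show "xs ! j \<noteq> xs ! i" if "j < i" "j < length xs" for j
      using assms that by (simp add: nth_eq_iff_index_eq)
  qed simp
  then show ?thesis using assms by (simp add: position_def)
qed

lemma length_takeWhile_neq: "x \<in> set xs \<Longrightarrow> length (takeWhile (\<lambda>y. y \<noteq> x) xs) < length xs"
  by (induction xs) auto

lemma position_range: "x \<in> set xs \<Longrightarrow> 0 \<le> position xs x \<and> position xs x < int (length xs)"
  unfolding position_def by (simp add: length_takeWhile_neq)

lemma nth_position:
  assumes "x \<in> set xs" shows "xs ! nat (position xs x) = x"
proof -
  have "\<not> (xs ! length (takeWhile (\<lambda>y. y \<noteq> x) xs) \<noteq> x)"
    by (rule nth_length_takeWhile) (rule length_takeWhile_neq[OF assms])
  then show ?thesis by (simp add: position_def)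
qed

locale enumerated_digraph = fin_digraph G for G :: "('a, 'b) pre_digraph" +
  fixes vs :: "'a list" and es :: "'b list"
  assumes vs: "distinct vs" "set vs = verts G" and es: "distinct es" "set es = arcs G"
begin

definition nv :: int where "nv = int (length vs)"
definition na :: int where "na = int (length es)"
definition arc_at :: "int \<Rightarrow> 'b" where "arc_at i = es ! nat i"
definition tl_at :: "int \<Rightarrow> int" where "tl_at i = position vs (tail G (arc_at i))"
definition hd_at :: "int \<Rightarrow> int" where "hd_at i = position vs (head G (arc_at i))"

lemma arc_at: "0 \<le> i \<Longrightarrow> i < na \<Longrightarrow> arc_at i \<in> arcs G"
  unfolding arc_at_def na_def using es(2) by (metis nat_less_iff nth_mem)

sublocale ix: index_digraph nv na tl_at hd_at
  by unfold_locales
    (use arc_at position_range[of _ vs] vs(2) in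
      \<open>auto simp: nv_def na_def tl_at_def hd_at_def\<close>)

lemma position_eq_iff: "x \<in> verts G \<Longrightarrow> y \<in> verts G \<Longrightarrow> position vs x = position vs y \<longleftrightarrow> x = y"
  using nth_position[of _ vs] vs(2) by metis

lemma position_arc: "e \<in> arcs G \<Longrightarrow> ix.arc (position es e) \<and> arc_at (position es e) = e"
  unfolding arc_at_def na_def using position_range nth_position es(2) by metis

lemma arc_at_inj: "inj_on arc_at {i. ix.arc i}"
  by (rule inj_onI) (metis (mono_tags, lifting) arc_at_def mem_Collect_eq na_def position_nth es(1)
      nat_0_le nat_less_iff)

lemma cas_walk:
  assumes "set p \<subseteq> {i. ix.arc i}" "u \<in> verts G" "v \<in> verts G"
  shows "cas u (map arc_at p) v \<longleftrightarrow> ix.walk (position vs u) p (position vs v)"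
  using assms
proof (induction p arbitrary: u)
  case Nil
  then show ?case by (simp add: position_eq_iff)
next
  case (Cons e p)
  have e: "arc_at e \<in> arcs G" using Cons.prems arc_at by auto
  have "tl_at e = position vs u \<longleftrightarrow> tail G (arc_at e) = u"
    unfolding tl_at_def using Cons.prems e by (simp add: position_eq_iff)
  moreover have "cas (head G (arc_at e)) (map arc_at p) v \<longleftrightarrow> ix.walk (hd_at e) p (position vs v)"
    using Cons.IH[of "head G (arc_at e)"] Cons.prems e by (simp add: hd_at_def[symmetric])
  ultimately show ?case using Cons.prems by simp
qed

lemma tl_awalk_verts: "cas u p v \<Longrightarrow> tl (awalk_verts u p) = map (head G) p"
proof (induction p arbitrary: u)
  case (Cons e p)
  then show ?case by (cases p) auto
qed simp

text \<open>\<open>position vs\<close> is injective on the vertices, so distinctness of heads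
  transfers between \<open>G\<close> and its indices.\<close>

lemma cycle_iff_dicycle:
  assumes p: "set p \<subseteq> {i. ix.arc i}"
  shows "cycle (map arc_at p) \<longleftrightarrow> ix.dicycle p"
proof -
  have arcs: "set (map arc_at p) \<subseteq> arcs G" using p arc_at by auto
  have heads: "distinct (map (head G) (map arc_at p)) \<longleftrightarrow> distinct (map hd_at p)"
  proof -
    have "map hd_at p = map (position vs) (map (head G) (map arc_at p))"
      by (simp add: hd_at_def)
    then have "distinct (map hd_at p) \<longleftrightarrow> distinct (map (head G) (map arc_at p)) \<and>
        inj_on (position vs) (set (map (head G) (map arc_at p)))"
      by (simp only: distinct_map)
    moreover have "inj_on (position vs) (set (map (head G) (map arc_at p)))"
    proof (rule inj_on_subset)
      show "inj_on (position vs) (verts G)" by (intro inj_onI) (simp add: position_eq_iff)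
      show "set (map (head G) (map arc_at p)) \<subseteq> verts G" using arcs by auto
    qed
    ultimately show ?thesis by blast
  qed
  show ?thesis
  proof
    assume "cycle (map arc_at p)"
    then obtain u where u: "u \<in> verts G" "cas u (map arc_at p) u"
      "distinct (tl (awalk_verts u (map arc_at p)))" "map arc_at p \<noteq> []"
      unfolding cycle_def awalk_def by blast
    have "ix.walk (position vs u) p (position vs u)" using cas_walk[OF p u(1) u(1)] u(2) by blast
    moreover have "distinct (map hd_at p)" using heads u(3) tl_awalk_verts[OF u(2)] by metis
    ultimately show "ix.dicycle p" unfolding ix.dicycle_def using u(4) by blast
  next
    assume d: "ix.dicycle p"
    then obtain x where x: "ix.walk x p x" "p \<noteq> []" "distinct (map hd_at p)"
      unfolding ix.dicycle_def by blast
    define u where "u = vs ! nat x"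
    have xr: "0 \<le> x" "nat x < length vs" using ix.walk_vert[OF x(1,2)] by (auto simp: nv_def)
    then have u: "u \<in> verts G" "position vs u = x"
      unfolding u_def using vs position_nth[of vs "nat x"] nth_mem[of "nat x" vs] by auto
    then have c: "cas u (map arc_at p) u" using cas_walk[OF p u(1) u(1)] x(1) by blast
    have "distinct (tl (awalk_verts u (map arc_at p)))" using heads x(3) tl_awalk_verts[OF c] by metis
    then show "cycle (map arc_at p)" unfolding cycle_def awalk_def
      using u(1) arcs x(2) c by blast
  qed
qed

lemma weighting_iff: "weighting G w \<longleftrightarrow> ix.index_weighting (\<lambda>i. w (arc_at i))"
proof -
  \<comment> \<open>A dicycle repeats no arc, so summing over its set of arcs and along its list
    give the same.\<close>
  have sum: "(\<Sum>e\<in>set (map arc_at p). w e) = (\<Sum>i\<leftarrow>p. w (arc_at i))" if "ix.dicycle p" for p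
  proof -
    have "distinct p" using that by (auto simp: ix.dicycle_def distinct_map)
    moreover have "inj_on arc_at (set p)"
      by (rule inj_on_subset[OF arc_at_inj]) (use ix.dicycle_arc[OF that] in auto)
    ultimately show ?thesis by (simp add: sum.reindex sum_list_distinct_conv_sum_set)
  qed
  show ?thesis
  proof
    assume w: "weighting G w"
    show "ix.index_weighting (\<lambda>i. w (arc_at i))" unfolding ix.index_weighting_def
    proof (intro allI impI)
      fix p assume p: "ix.dicycle p"
      then have "cycle (map arc_at p)" using cycle_iff_dicycle[of p] ix.dicycle_arc by blast
      then have "(\<Sum>e\<in>set (map arc_at p). w e) = 1" using w unfolding weighting_def by blast
      then show "(\<Sum>i\<leftarrow>p. w (arc_at i)) = 1" using sum[OF p] by simp
    qed
  next
    assume w: "ix.index_weighting (\<lambda>i. w (arc_at i))"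
    show "weighting G w" unfolding weighting_def
    proof (intro allI impI)
      fix C assume C: "cycle C"
      define p where "p = map (position es) C"
      have CA: "set C \<subseteq> arcs G" using C by (auto simp: cycle_def awalk_def)
      then have Cp: "map arc_at p = C" unfolding p_def
        using position_arc by (auto simp: map_idI subset_iff)
      have "set p \<subseteq> {i. ix.arc i}" using CA position_arc by (auto simp: p_def)
      then have p: "ix.dicycle p" using cycle_iff_dicycle[of p] C Cp by simp
      then show "(\<Sum>e\<in>set C. w e) = 1" using w sum[OF p] Cp by (simp add: ix.index_weighting_def)
    qed
  qed
qed

end

section \<open>The algorithm\<close>

declare run.simps(5) [simp del]

abbreviation var :: "string \<Rightarrow> exp" where "var x \<equiv> Read x (Const 0)"
abbreviation set_var :: "string \<Rightarrow> exp \<Rightarrow> prog" where "set_var x e \<equiv> Assign x (Const 0) e"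
abbreviation order_exp :: exp where "order_exp \<equiv> Read ''in'' (Const 1)"
text \<open>Cell 0 of \<open>in\<close> is the length of the code, cells 1 and 2 are n and m, and
  the vertices occupy cells 3 to n + 2; hence arc e has its ends at 3 + n + 2 e and 4 + n + 2 e.
  Doubling is a sum because \<open>tame_exp\<close> admits only products whose right factor is an
  input cell.\<close>

abbreviation tail_exp :: "exp \<Rightarrow> exp" where
  "tail_exp e \<equiv> Read ''in'' (Plus (Const 3) (Plus order_exp (Plus e e)))"
abbreviation head_exp :: "exp \<Rightarrow> exp" where
  "head_exp e \<equiv> Read ''in'' (Plus (Const 4) (Plus order_exp (Plus e e)))"
abbreviation cell_exp :: "exp \<Rightarrow> exp \<Rightarrow> exp" where
  "cell_exp t x \<equiv> Plus (Times t order_exp) x"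

definition if_eq :: "exp \<Rightarrow> exp \<Rightarrow> prog \<Rightarrow> prog \<Rightarrow> prog" where
  "if_eq a b c d = Cond (Minus a b) d (Cond (Minus b a) d c)"

lemma if_eq_simps [simp]:
  "run (if_eq a b c d) s = (if val a s = val b s then run c s else run d s)"
  "writes (if_eq a b c d) = writes c \<union> writes d"
  "tame (if_eq a b c d) \<longleftrightarrow> tame_exp a \<and> tame_exp b \<and> tame c \<and> tame d"
  by (auto simp: if_eq_def)

text \<open>
  Row \<open>t\<close> of the tables \<open>rc\<close> and \<open>nx\<close> (at cells \<open>t * n + x\<close>) tells which vertices \<open>x\<close> reach \<open>t\<close>,
  and the first arc of a walk from \<open>x\<close> to \<open>t\<close>.
\<close>

definition relax :: prog where
  "relax =
     Cond (Read ''rc'' (cell_exp (var ''t'') (head_exp (var ''a''))))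
       (Cond (Read ''rc'' (cell_exp (var ''t'') (tail_exp (var ''a''))))
          Halt
          (Assign ''rc'' (cell_exp (var ''t'') (tail_exp (var ''a''))) (Const 1) ;;
           Assign ''nx'' (cell_exp (var ''t'') (tail_exp (var ''a''))) (var ''a'')))
       Halt"

text \<open>For each target all arcs are relaxed n times, enough for walks of at most n arcs. An
  entry of \<open>nx\<close> is written only when its vertex is first marked, so following the
  entries cannot run in circles.\<close>

definition reach :: prog where
  "reach = For ''t'' 1
     (Assign ''rc'' (cell_exp (var ''t'') (var ''t'')) (Const 1) ;;
      For ''k'' 1 (For ''a'' 2 relax))"

text \<open>
  \<open>step\<close> appends the arc \<open>a\<close> to a walk. The bank \<open>stk\<close> holds the vertices of the loop-erased walk
  in its cells 1 to \<open>tp\<close>, and \<open>pos\<close> their positions; positions of erased vertices are left behind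
  and recognised by comparing them with \<open>tp\<close> and \<open>stk\<close>. Each erased dicycle adds \<open>d\<close> to \<open>z\<close>.
\<close>

definition push :: prog where
  "push = set_var ''tp'' (Plus (var ''tp'') (Const 1)) ;;
     Assign ''stk'' (var ''tp'') (var ''x'') ;;
     Assign ''pos'' (var ''x'') (var ''tp'')"

definition pop :: prog where
  "pop = set_var ''tp'' (Read ''pos'' (var ''x'')) ;; set_var ''z'' (Plus (var ''z'') (var ''d''))"

text \<open>Over a walk \<open>z\<close> collects \<open>d\<close> for each erased dicycle minus
  \<open>g\<close> of each traversed arc; for \<open>d = 1\<close> and \<open>g = 0\<close> it
  counts dicycles. Positions start at 1, so 0, the initial content of \<open>pos\<close>, means
  unvisited.\<close>

definition step :: prog where
  "step = set_var ''z'' (Minus (var ''z'') (Read ''g'' (var ''a''))) ;;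
     set_var ''x'' (head_exp (var ''a'')) ;;
     Cond (Read ''pos'' (var ''x''))
       (Cond (Minus (Plus (var ''tp'') (Const 1)) (Read ''pos'' (var ''x'')))
          (if_eq (Read ''stk'' (Read ''pos'' (var ''x''))) (var ''x'') pop push)
          push)
       push"

definition start :: prog where
  "start = set_var ''x'' (var ''r'') ;; set_var ''tp'' (Const 1) ;;
     Assign ''stk'' (Const 1) (var ''r'') ;; Assign ''pos'' (var ''r'') (Const 1)"

text \<open>A chosen walk has at most n arcs, so n rounds reach the target; rounds after arrival are
  idle.\<close>

definition walk_to :: "exp \<Rightarrow> prog" where
  "walk_to b = set_var ''y'' b ;;
     For ''j'' 1 (if_eq (var ''x'') (var ''y'') Halt
       (set_var ''a'' (Read ''nx'' (cell_exp (var ''y'') (var ''x''))) ;; step))"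

definition arc_step :: prog where
  "arc_step = set_var ''a'' (var ''e'') ;; step"

text \<open>
  If \<open>r\<close> reaches the tail \<open>u\<close> and the head \<open>v\<close> of \<open>e\<close> reaches \<open>r\<close>, then \<open>z\<close> receives the difference
  between the closed walks \<open>r \<rightarrow> u \<rightarrow> v \<rightarrow> r\<close> (via \<open>e\<close>) and \<open>r \<rightarrow> v \<rightarrow> r\<close>.
\<close>

definition compare_walks :: prog where
  "compare_walks = set_var ''z'' (Const 0) ;;
     start ;; walk_to (var ''v'') ;; walk_to (var ''r'') ;;
     set_var ''z'' (Minus (Const 0) (var ''z'')) ;;
     start ;; walk_to (var ''u'') ;; arc_step ;; walk_to (var ''r'')"

text \<open>Search and test share this frame and differ in the action \<open>fin\<close> on the
  final \<open>z\<close>. Rows of \<open>rc\<close> belong to targets, so row \<open>u\<close> is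
  asked about \<open>r\<close> and row \<open>r\<close> about \<open>v\<close>.\<close>

definition process :: "prog \<Rightarrow> prog" where
  "process fin = set_var ''u'' (tail_exp (var ''e'')) ;; set_var ''v'' (head_exp (var ''e'')) ;;
     Cond (Read ''rc'' (cell_exp (var ''u'') (var ''r'')))
       (Cond (Read ''rc'' (cell_exp (var ''r'') (var ''v''))) (compare_walks ;; fin) Halt)
       Halt"

section \<open>Written banks and tameness of the program fragments\<close>

lemma writes_relax [simp]: "writes relax = {''rc'', ''nx''}"
  and tame_relax [simp]: "tame relax"
  by (auto simp: relax_def)

lemma writes_reach [simp]: "writes reach = {''t'', ''k'', ''a'', ''rc'', ''nx''}"
  and tame_reach [simp]: "tame reach"
  by (auto simp: reach_def)

lemma writes_step [simp]: "writes step = {''z'', ''x'', ''tp'', ''stk'', ''pos''}"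
  and tame_step [simp]: "tame step"
  by (auto simp: step_def push_def pop_def)

lemma writes_start [simp]: "writes start = {''x'', ''tp'', ''stk'', ''pos''}"
  and tame_start [simp]: "tame start"
  by (auto simp: start_def)

lemma writes_walk_to [simp]:
  "writes (walk_to b) = {''y'', ''j'', ''a'', ''z'', ''x'', ''tp'', ''stk'', ''pos''}"
  and tame_walk_to [simp]: "tame (walk_to b) \<longleftrightarrow> tame_exp b"
  by (auto simp: walk_to_def)

lemma writes_arc_step [simp]: "writes arc_step = {''a'', ''z'', ''x'', ''tp'', ''stk'', ''pos''}"
  and tame_arc_step [simp]: "tame arc_step"
  by (auto simp: arc_step_def)

lemma writes_compare_walks [simp]:
  "writes compare_walks = {''y'', ''j'', ''a'', ''z'', ''x'', ''tp'', ''stk'', ''pos''}"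
  and tame_compare_walks [simp]: "tame compare_walks"
  by (auto simp: compare_walks_def)

lemma writes_process [simp]:
  "writes (process fin) =
     {''u'', ''v'', ''y'', ''j'', ''a'', ''z'', ''x'', ''tp'', ''stk'', ''pos''} \<union> writes fin"
  and tame_process [simp]: "tame (process fin) \<longleftrightarrow> tame fin"
  by (auto simp: process_def)

context index_digraph
begin

definition graph_in :: "store \<Rightarrow> bool" where
  "graph_in s \<longleftrightarrow> s ''in'' 1 = n \<and> s ''in'' 2 = m \<and>
     (\<forall>e. arc e \<longrightarrow> s ''in'' (3 + (n + (e + e))) = T e \<and> s ''in'' (4 + (n + (e + e))) = H e)"

lemma graph_in_cong: "s' ''in'' = s ''in'' \<Longrightarrow> graph_in s' \<longleftrightarrow> graph_in s"
  by (simp add: graph_in_def)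

subsection \<open>Reachability\<close>

text \<open>The trace of the pointers \<open>N\<close> from \<open>x\<close> until \<open>t\<close>
  is first met. Unlike a walk it is determined by \<open>N\<close>, and it stops where
  \<open>walk_to\<close> stops.\<close>

fun follow :: "(int \<Rightarrow> int) \<Rightarrow> int \<Rightarrow> int \<Rightarrow> int list \<Rightarrow> bool" where
  "follow N t x [] \<longleftrightarrow> x = t"
| "follow N t x (e # p) \<longleftrightarrow> x \<noteq> t \<and> N x = e \<and> arc e \<and> T e = x \<and> follow N t (H e) p"

lemma follow_walk: "follow N t x p \<Longrightarrow> walk x p t"
  by (induction p arbitrary: x) auto

lemma follow_cong: "follow N t x p \<Longrightarrow> (\<And>e. e \<in> set p \<Longrightarrow> N' (T e) = N (T e)) \<Longrightarrow> follow N' t x p"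
  by (induction p arbitrary: x) auto

text \<open>Pointer walks leave only marked vertices, so marking a new vertex cannot disturb them.
  The strict length bound grows with each marking and in the end keeps the lengths within n.\<close>

definition row_ok :: "(int \<Rightarrow> int) \<Rightarrow> (int \<Rightarrow> int) \<Rightarrow> int \<Rightarrow> bool" where
  "row_ok R N t \<longleftrightarrow> R t > 0 \<and> (\<forall>x. vert x \<longrightarrow> R x > 0 \<longrightarrow>
     (\<exists>p. follow N t x p \<and> (\<forall>e\<in>set p. R (T e) > 0) \<and> length p < card {y. vert y \<and> R y > 0}))"

lemma finite_verts: "finite {y. vert y \<and> P y}"
  by (rule finite_subset[of _ "{0..<n}"]) auto

lemma row_ok_init:
  assumes "vert t" "\<And>x. vert x \<Longrightarrow> x \<noteq> t \<Longrightarrow> R x = 0" "R t = 1"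
  shows "row_ok R N t"
proof -
  have "{y. vert y \<and> R y > 0} = {t}" using assms by force
  moreover have "\<exists>p. follow N t x p \<and> (\<forall>e\<in>set p. R (T e) > 0) \<and> length p < card {t}"
    if "vert x" "R x > 0" for x
    using that assms(2)[of x] by (intro exI[of _ "[]"]) auto
  ultimately show ?thesis unfolding row_ok_def using assms(3) by simp
qed

text \<open>\<open>T a\<close> was unmarked, so its pointer is used by no old pointer walk. Its own
  walk is \<open>a\<close> followed by that of \<open>H a\<close>: one arc more, for a marked set
  with one vertex more.\<close>

lemma row_ok_relax:
  assumes row: "row_ok R N t" and a: "arc a" "R (H a) > 0" "\<not> R (T a) > 0"
  shows "row_ok (R(T a := 1)) (N(T a := a)) t"
proof -
  let ?V = "\<lambda>R. {y. vert y \<and> R y > (0::int)}"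
  have t: "R t > 0" "T a \<noteq> t" using row a by (auto simp: row_ok_def)
  have V: "?V (R(T a := 1)) = insert (T a) (?V R)" using T_range[of a] a by auto
  have card: "card (?V (R(T a := 1))) = Suc (card (?V R))"
    unfolding V by (rule card_insert_disjoint) (use a finite_verts in auto)
  have old: "\<exists>p. follow (N(T a := a)) t x p \<and> (\<forall>e\<in>set p. R (T e) > 0) \<and> length p < card (?V R)"
    if x: "vert x" "R x > 0" for x
  proof -
    obtain p where p: "follow N t x p" "\<forall>e\<in>set p. R (T e) > 0" "length p < card (?V R)"
      using row x by (auto simp: row_ok_def)
    have "follow (N(T a := a)) t x p" by (rule follow_cong[OF p(1)]) (use p(2) a in auto)
    then show ?thesis using p by blast
  qed
  have "\<exists>p. follow (N(T a := a)) t x p \<and> (\<forall>e\<in>set p. (R(T a := 1)) (T e) > 0) \<and>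
      length p < card (?V (R(T a := 1)))"
    if x: "vert x" "(R(T a := 1)) x > 0" for x
  proof (cases "x = T a")
    case True
    obtain p where p: "follow (N(T a := a)) t (H a) p" "\<forall>e\<in>set p. R (T e) > 0"
      "length p < card (?V R)"
      using old[of "H a"] a H_range by blast
    then show ?thesis using True t a card by (intro exI[of _ "a # p"]) auto
  next
    case False
    then obtain p where "follow (N(T a := a)) t x p" "\<forall>e\<in>set p. R (T e) > 0" "length p < card (?V R)"
      using old[of x] x by auto
    then show ?thesis using card by (intro exI[of _ p]) auto
  qed
  then show ?thesis unfolding row_ok_def using t by auto
qed

text \<open>Division by \<open>n\<close> recovers the row from an address, so writing to one row
  leaves the others intact.\<close>

lemma cell_eq_iff:
  assumes "vert x" "vert x'" shows "t * n + x = t' * n + x' \<longleftrightarrow> t = t' \<and> x = x'"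
proof
  assume eq: "t * n + x = t' * n + x'"
  have "(t * n + x) div n = t" "(t' * n + x') div n = t'" using assms by auto
  then show "t = t' \<and> x = x'" using eq by simp
qed simp

abbreviation row :: "string \<Rightarrow> store \<Rightarrow> int \<Rightarrow> int \<Rightarrow> int" where
  "row b s t x \<equiv> s b (t * n + x)"

text \<open>Completeness is limited to walks of at most \<open>n\<close> arcs, which is what
  \<open>n\<close> rounds provide; \<open>walk_shorten\<close> extends it to all walks.\<close>

definition reach_ok :: "store \<Rightarrow> int \<Rightarrow> bool" where
  "reach_ok s t \<longleftrightarrow> row_ok (row ''rc'' s t) (row ''nx'' s t) t \<and>
     (\<forall>x p. vert x \<longrightarrow> walk x p t \<longrightarrow> int (length p) \<le> n \<longrightarrow> row ''rc'' s t x > 0)"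

lemma run_relax:
  assumes "graph_in s" "s ''t'' 0 = t" "s ''a'' 0 = a" "arc a"
  shows "run relax s = (if row ''rc'' s t (H a) > 0 \<and> \<not> row ''rc'' s t (T a) > 0
    then upd ''nx'' (t * n + T a) a (upd ''rc'' (t * n + T a) 1 s) else s)"
  using assms by (simp add: relax_def graph_in_def)

definition other_rows :: "int \<Rightarrow> store \<Rightarrow> store \<Rightarrow> bool" where
  "other_rows t s s' \<longleftrightarrow> (\<forall>t' x. t' \<noteq> t \<longrightarrow> vert x \<longrightarrow>
     row ''rc'' s' t' x = row ''rc'' s t' x \<and> row ''nx'' s' t' x = row ''nx'' s t' x)"

lemma row_ok_other_rows:
  assumes "vert t" "other_rows t' s s'" "t \<noteq> t'" and ok: "row_ok (row ''rc'' s t) (row ''nx'' s t) t"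
  shows "row_ok (row ''rc'' s' t) (row ''nx'' s' t) t"
proof -
  have eq: "row ''rc'' s' t x = row ''rc'' s t x" "row ''nx'' s' t x = row ''nx'' s t x" if "vert x" for x
    using assms that by (auto simp: other_rows_def)
  have V: "{y. vert y \<and> row ''rc'' s' t y > 0} = {y. vert y \<and> row ''rc'' s t y > 0}"
    using eq by auto
  show ?thesis unfolding row_ok_def V
  proof (intro conjI allI impI)
    show "row ''rc'' s' t t > 0" using ok assms eq by (simp add: row_ok_def)
    fix x assume x: "vert x" "row ''rc'' s' t x > 0"
    then have "row ''rc'' s t x > 0" using eq by simp
    then obtain p where p: "follow (row ''nx'' s t) t x p" "\<forall>e\<in>set p. row ''rc'' s t (T e) > 0"
      "length p < card {y. vert y \<and> row ''rc'' s t y > 0}"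
      using ok x(1) unfolding row_ok_def by blast
    have T: "vert (T e)" if "e \<in> set p" for e
      using walk_arcs[OF follow_walk[OF p(1)] that] T_range by blast
    have "follow (row ''nx'' s' t) t x p" by (rule follow_cong[OF p(1)]) (use eq T in auto)
    then show "\<exists>p. follow (row ''nx'' s' t) t x p \<and> (\<forall>e\<in>set p. row ''rc'' s' t (T e) > 0) \<and>
        length p < card {y. vert y \<and> row ''rc'' s t y > 0}"
      using p T eq by (intro exI[of _ p]) auto
  qed
qed

text \<open>Relaxation works in place, so one round may mark several layers. Only marks present at
  the start are claimed to propagate; this is safe as marks are never removed.\<close>

lemma run_relax_round:
  assumes g: "graph_in s" and t: "s ''t'' 0 = t" and ok: "row_ok (row ''rc'' s t) (row ''nx'' s t) t"
  defines "s' \<equiv> run (For ''a'' 2 relax) s"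
  shows "other_rows t s s'" "row_ok (row ''rc'' s' t) (row ''nx'' s' t) t"
    "\<And>x. row ''rc'' s t x > 0 \<Longrightarrow> row ''rc'' s' t x > 0"
    "\<And>a. arc a \<Longrightarrow> row ''rc'' s t (H a) > 0 \<Longrightarrow> row ''rc'' s' t (T a) > 0"
proof -
  define P where "P j s' \<longleftrightarrow> other_rows t s s' \<and> row_ok (row ''rc'' s' t) (row ''nx'' s' t) t \<and>
    (\<forall>x. row ''rc'' s t x > 0 \<longrightarrow> row ''rc'' s' t x > 0) \<and>
    (\<forall>a. 0 \<le> a \<longrightarrow> a < int j \<longrightarrow> row ''rc'' s t (H a) > 0 \<longrightarrow> row ''rc'' s' t (T a) > 0)" for j s'
  have "P (nat m) s'" unfolding s'_def
  proof (rule run_For_invariant)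
    show "P 0 (upd ''a'' 0 0 s)" using ok by (simp add: P_def other_rows_def)
    show "nat m = nat (s ''in'' 2)" using g by (simp add: graph_in_def)
    fix j s' assume j: "j < nat m" "s' ''a'' 0 = int j"
      and fr: "\<And>x. x \<noteq> ''a'' \<Longrightarrow> x \<notin> writes relax \<Longrightarrow> s' x = s x" and P: "P j s'"
    have g': "graph_in s'" using g fr by (subst graph_in_cong[of _ s]) auto
    have t': "s' ''t'' 0 = t" using t fr by simp
    have a: "arc (int j)" using j by auto
    have T: "vert (T (int j))" by (rule T_range) (use a in auto)
    note r = run_relax[OF g' t' j(2) a]
    show "P (Suc j) (upd ''a'' 0 (int (Suc j)) (run relax s'))"
    proof (cases "row ''rc'' s' t (H (int j)) > 0 \<and> \<not> row ''rc'' s' t (T (int j)) > 0")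
      case True
      let ?s = "run relax s'"
      have R: "?s ''rc'' = (s' ''rc'')(t * n + T (int j) := 1)"
        and N: "?s ''nx'' = (s' ''nx'')(t * n + T (int j) := int j)"
        using r True by (auto simp: upd_def)
      have "row_ok ((row ''rc'' s' t)(T (int j) := 1)) ((row ''nx'' s' t)(T (int j) := int j)) t"
        using P True a by (intro row_ok_relax) (auto simp: P_def)
      moreover have "(row ''rc'' s' t)(T (int j) := 1) = row ''rc'' ?s t"
        "(row ''nx'' s' t)(T (int j) := int j) = row ''nx'' ?s t"
        by (auto simp: R N)
      ultimately have "row_ok (row ''rc'' ?s t) (row ''nx'' ?s t) t" by simp
      moreover have "other_rows t s ?s" using P T cell_eq_iff
        by (auto simp: P_def other_rows_def R N)
      moreover have "\<forall>x. row ''rc'' s t x > 0 \<longrightarrow> row ''rc'' ?s t x > 0"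
        using P by (auto simp: P_def R)
      moreover have "\<forall>a. 0 \<le> a \<longrightarrow> a < int (Suc j) \<longrightarrow> row ''rc'' s t (H a) > 0 \<longrightarrow> row ''rc'' ?s t (T a) > 0"
      proof (intro allI impI)
        fix a assume "0 \<le> a" "a < int (Suc j)" "row ''rc'' s t (H a) > 0"
        then show "row ''rc'' ?s t (T a) > 0"
          using P by (cases "a = int j") (auto simp: P_def R)
      qed
      ultimately show ?thesis by (simp add: P_def other_rows_def)
    next
      case False
      then have eq: "run relax s' = s'" using r by auto
      have "\<forall>a. 0 \<le> a \<longrightarrow> a < int (Suc j) \<longrightarrow> row ''rc'' s t (H a) > 0 \<longrightarrow> row ''rc'' s' t (T a) > 0"
      proof (intro allI impI)
        fix a assume "0 \<le> a" "a < int (Suc j)" "row ''rc'' s t (H a) > 0"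
        then show "row ''rc'' s' t (T a) > 0"
          using P False by (cases "a = int j") (auto simp: P_def)
      qed
      then show ?thesis using P by (simp add: P_def other_rows_def eq)
    qed
  qed auto
  then show "other_rows t s s'" "row_ok (row ''rc'' s' t) (row ''nx'' s' t) t"
    "\<And>x. row ''rc'' s t x > 0 \<Longrightarrow> row ''rc'' s' t x > 0"
    "\<And>a. arc a \<Longrightarrow> row ''rc'' s t (H a) > 0 \<Longrightarrow> row ''rc'' s' t (T a) > 0"
    by (auto simp: P_def)
qed

lemma run_relax_rounds:
  assumes g: "graph_in s" and t: "s ''t'' 0 = t" and ok: "row_ok (row ''rc'' s t) (row ''nx'' s t) t"
  defines "s' \<equiv> run (For ''k'' 1 (For ''a'' 2 relax)) s"
  shows "other_rows t s s'" "reach_ok s' t"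
proof -
  define P where "P j s' \<longleftrightarrow> other_rows t s s' \<and> row_ok (row ''rc'' s' t) (row ''nx'' s' t) t \<and>
    (\<forall>x p. walk x p t \<longrightarrow> length p \<le> j \<longrightarrow> row ''rc'' s' t x > 0)" for j s'
  have "P (nat n) s'" unfolding s'_def
  proof (rule run_For_invariant)
    show "P 0 (upd ''k'' 0 0 s)" using ok by (simp add: P_def other_rows_def row_ok_def)
    show "nat n = nat (s ''in'' 1)" using g by (simp add: graph_in_def)
    fix j s'
    assume fr: "\<And>x. x \<noteq> ''k'' \<Longrightarrow> x \<notin> writes (For ''a'' 2 relax) \<Longrightarrow> s' x = s x" and P: "P j s'"
    have g': "graph_in s'" using g fr by (subst graph_in_cong[of _ s]) auto
    have t': "s' ''t'' 0 = t" using t fr by simp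
    have ok': "row_ok (row ''rc'' s' t) (row ''nx'' s' t) t" using P by (simp add: P_def)
    let ?s = "run (For ''a'' 2 relax) s'"
    note r = run_relax_round[OF g' t' ok']
    have "row ''rc'' ?s t x > 0" if w: "walk x p t" "length p \<le> Suc j" for x p
    proof (cases p)
      case Nil
      then show ?thesis using w r(2) by (simp add: row_ok_def)
    next
      case (Cons e q)
      then have "row ''rc'' s' t (H e) > 0" using P w unfolding P_def by auto
      then show ?thesis using r(4)[of e] w Cons by auto
    qed
    moreover have "other_rows t s ?s" using r(1) P by (auto simp: P_def other_rows_def)
    ultimately show "P (Suc j) (upd ''k'' 0 (int (Suc j)) ?s)"
      using r(2) by (simp add: P_def other_rows_def)
  qed auto
  then show "other_rows t s s'" "reach_ok s' t" using n_nonneg by (auto simp: P_def reach_ok_def)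
qed

text \<open>Finished rows must survive the work on later ones, and later rows must still be blank,
  because each row starts with its target as the only marked vertex.\<close>

lemma run_reach:
  assumes g: "graph_in s" and rc: "\<And>i. s ''rc'' i = 0" and t: "vert t"
  shows "reach_ok (run reach s) t"
proof -
  let ?c = "Assign ''rc'' (cell_exp (var ''t'') (var ''t'')) (Const 1) ;;
      For ''k'' 1 (For ''a'' 2 relax)"
  define P where "P j s' \<longleftrightarrow> (\<forall>t. vert t \<longrightarrow> t < int j \<longrightarrow> reach_ok s' t) \<and>
    (\<forall>t x. vert x \<longrightarrow> int j \<le> t \<longrightarrow> row ''rc'' s' t x = 0)" for j s'
  have "P (nat n) (run reach s)" unfolding reach_def
  proof (rule run_For_invariant)
    show "P 0 (upd ''t'' 0 0 s)" using rc by (simp add: P_def)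
    show "nat n = nat (s ''in'' 1)" using g by (simp add: graph_in_def)
    fix j s'
    assume j: "j < nat n" "s' ''t'' 0 = int j"
      and fr: "\<And>x. x \<noteq> ''t'' \<Longrightarrow> x \<notin> writes ?c \<Longrightarrow> s' x = s x" and P: "P j s'"
    let ?t = "int j"
    have vt: "vert ?t" using j by auto
    have in': "s' ''in'' = s ''in''" using fr by simp
    then have n: "s' ''in'' 1 = n" using g by (simp add: graph_in_def)
    define s1 where "s1 = upd ''rc'' (?t * n + ?t) 1 s'"
    define s2 where "s2 = run (For ''k'' 1 (For ''a'' 2 relax)) s1"
    have r: "run ?c s' = s2" using j n by (simp add: s1_def s2_def)
    have g1: "graph_in s1" using g in' by (subst graph_in_cong[of _ s]) (auto simp: s1_def)
    have t1: "s1 ''t'' 0 = ?t" using j by (simp add: s1_def)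
    have o1: "other_rows ?t s' s1"
      using vt cell_eq_iff by (auto simp: other_rows_def s1_def upd_same)
    have "row_ok (row ''rc'' s1 ?t) (row ''nx'' s1 ?t) ?t"
      using vt P by (intro row_ok_init) (auto simp: s1_def upd_same P_def)
    note r2 = run_relax_rounds[OF g1 t1 this, folded s2_def]
    have o2: "other_rows ?t s' s2" using o1 r2(1) by (auto simp: other_rows_def)
    have "reach_ok s2 t" if "vert t" "t < int (Suc j)" for t
    proof (cases "t = ?t")
      case True
      then show ?thesis using r2(2) by simp
    next
      case False
      then have "reach_ok s' t" using P that by (auto simp: P_def)
      then show ?thesis using row_ok_other_rows[OF that(1) o2 False] o2 False
        unfolding reach_ok_def by (auto simp: other_rows_def)
    qed
    moreover have "row ''rc'' s2 t x = 0" if "vert x" "int (Suc j) \<le> t" for t x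
      using that o2 P by (auto simp: P_def other_rows_def)
    ultimately have "P (Suc j) s2" by (simp add: P_def)
    then show "P (Suc j) (upd ''t'' 0 (int (Suc j)) (run ?c s'))"
      unfolding r by (simp add: P_def reach_ok_def)
  qed auto
  then show ?thesis using t by (simp add: P_def)
qed

end

section \<open>Canonical walks, and arcs within the strong component of a root\<close>

context index_digraph
begin

text \<open>Between two arcs with the same tail a closed part can be cut out. A walk without such a
  pair has at most \<open>n\<close> arcs.\<close>

lemma walk_shorten:
  assumes "walk x p y"
  obtains q where "walk x q y" "int (length q) \<le> n"
proof -
  have "\<exists>q. walk x q y \<and> distinct (map T q)" using assms
  proof (induction "length p" arbitrary: p rule: less_induct)
    case less
    show ?case
    proof (cases "distinct (map T p)")
      case False
      then obtain us c vs ws where "map T p = us @ [c] @ vs @ [c] @ ws"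
        using not_distinct_decomp by blast
      then obtain p1 e p2 f p3 where p: "p = p1 @ e # p2 @ f # p3" "T e = c" "T f = c"
        by (auto simp: map_eq_append_conv map_eq_Cons_conv append_eq_map_conv Cons_eq_map_conv)
      have "walk x (p1 @ f # p3) y" using less.prems p by (auto simp: walk_append)
      then show ?thesis using less.hyps[of "p1 @ f # p3"] p(1) by simp
    qed (use less.prems in blast)
  qed
  then obtain q where q: "walk x q y" "distinct (map T q)" by blast
  have "set (map T q) \<subseteq> {0..<n}" using walk_arcs[OF q(1)] T_range by auto
  then have "card (set (map T q)) \<le> card {0..<n}" by (intro card_mono) auto
  moreover have "card (set (map T q)) = length q" using distinct_card[OF q(2)] by simp
  ultimately show ?thesis using that[OF q(1)] n_nonneg by simp
qed

lemma reach_ok_iff: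
  assumes "reach_ok s t" "vert x"
  shows "row ''rc'' s t x > 0 \<longleftrightarrow> (\<exists>p. walk x p t)"
proof
  assume "row ''rc'' s t x > 0"
  then show "\<exists>p. walk x p t" using assms follow_walk unfolding reach_ok_def row_ok_def by blast
next
  assume "\<exists>p. walk x p t"
  then obtain q where "walk x q t" "int (length q) \<le> n" using walk_shorten by blast
  then show "row ''rc'' s t x > 0" using assms unfolding reach_ok_def by blast
qed

text \<open>\<open>follow\<close> admits at most one list, so \<open>SOME\<close> merely names it.
  The argument \<open>N\<close> is the whole bank \<open>nx\<close>, on which alone the path
  depends.\<close>

definition path :: "(int \<Rightarrow> int) \<Rightarrow> int \<Rightarrow> int \<Rightarrow> int list" where
  "path N x t = (SOME p. follow (\<lambda>y. N (t * n + y)) t x p \<and> int (length p) \<le> n)"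

lemma path:
  assumes "reach_ok s t" "vert x" "walk x p t"
  shows "follow (row ''nx'' s t) t x (path (s ''nx'') x t)"
    "int (length (path (s ''nx'') x t)) \<le> n"
proof -
  have "row ''rc'' s t x > 0" using reach_ok_iff[OF assms(1,2)] assms(3) by blast
  then obtain p where p: "follow (row ''nx'' s t) t x p"
    "length p < card {y. vert y \<and> row ''rc'' s t y > 0}"
    using assms(1,2) unfolding reach_ok_def row_ok_def by blast
  have "card {y. vert y \<and> row ''rc'' s t y > 0} \<le> card {0..<n}" by (intro card_mono) auto
  then have "int (length p) \<le> n" using p(2) n_nonneg by simp
  then have "follow (\<lambda>y. (s ''nx'') (t * n + y)) t x p \<and> int (length p) \<le> n" using p by simp
  then have "follow (\<lambda>y. (s ''nx'') (t * n + y)) t x (path (s ''nx'') x t) \<and>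
      int (length (path (s ''nx'') x t)) \<le> n"
    unfolding path_def by (rule someI)
  then show "follow (row ''nx'' s t) t x (path (s ''nx'') x t)"
    "int (length (path (s ''nx'') x t)) \<le> n" by auto
qed

text \<open>For an arc \<open>e\<close> this says that both its ends lie in the strong component of
  \<open>r\<close>.\<close>

definition linked :: "int \<Rightarrow> int \<Rightarrow> bool" where
  "linked r e \<longleftrightarrow> (\<exists>p. walk r p (T e)) \<and> (\<exists>p. walk (H e) p r)"

text \<open>A dicycle lies in a single strong component, so the pass for a root treats all its arcs
  or none.\<close>

lemma linked_dicycle:
  assumes "dicycle C" "e \<in> set C" "f \<in> set C" "linked r e" shows "linked r f"
proof -
  obtain q q' where "walk (H e) q (T f)" "walk (H f) q' (T e)"
    using dicycle_walk_to[OF assms(1)] assms(2,3) by metis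
  moreover obtain p p' where "walk r p (T e)" "walk (H e) p' r"
    using assms(4) by (auto simp: linked_def)
  moreover have "arc e" using dicycle_arc[OF assms(1,2)] .
  ultimately have "walk r (p @ e # q) (T f)" "walk (H f) (q' @ e # p') r"
    by (auto simp: walk_append)
  then show ?thesis unfolding linked_def by blast
qed

lemma linked_tail:
  assumes "dicycle C" "e \<in> set C" shows "linked (T e) e"
proof -
  obtain q where "walk (H e) q (T e)" using dicycle_walk_to[OF assms(1,2,2)] by metis
  moreover have "walk (T e) [] (T e)" by simp
  ultimately show ?thesis unfolding linked_def by blast
qed

subsection \<open>Loop erasure\<close>

lemma run_step:
  assumes "graph_in s" "s ''a'' 0 = a" "arc a"
  defines "on \<equiv> 0 < s ''pos'' (H a) \<and> s ''pos'' (H a) \<le> s ''tp'' 0 \<and>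
    s ''stk'' (s ''pos'' (H a)) = H a"
  shows "run step s ''x'' 0 = H a"
    "run step s ''z'' 0 = s ''z'' 0 - s ''g'' a + (if on then s ''d'' 0 else 0)"
    "run step s ''tp'' 0 = (if on then s ''pos'' (H a) else s ''tp'' 0 + 1)"
    "run step s ''stk'' = (if on then s ''stk'' else (s ''stk'')(s ''tp'' 0 + 1 := H a))"
    "run step s ''pos'' = (if on then s ''pos'' else (s ''pos'')(H a := s ''tp'' 0 + 1))"
proof -
  have h: "s ''in'' (4 + (s ''in'' 1 + (a + a))) = H a" using assms by (simp add: graph_in_def)
  show "run step s ''x'' 0 = H a"
    "run step s ''z'' 0 = s ''z'' 0 - s ''g'' a + (if on then s ''d'' 0 else 0)"
    "run step s ''tp'' 0 = (if on then s ''pos'' (H a) else s ''tp'' 0 + 1)"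
    "run step s ''stk'' = (if on then s ''stk'' else (s ''stk'')(s ''tp'' 0 + 1 := H a))"
    "run step s ''pos'' = (if on then s ''pos'' else (s ''pos'')(H a := s ''tp'' 0 + 1))"
    by (auto simp: step_def push_def pop_def upd_def h h[simplified] assms(2) on_def)
qed

text \<open>\<open>q\<close> is the loop-erased walk, with the root stored at position 1. Cells not
  belonging to it are unconstrained, which admits stale positions. As \<open>pos\<close> inverts
  \<open>stk\<close> on the walk, its vertices are automatically distinct.\<close>

definition stack :: "store \<Rightarrow> int \<Rightarrow> int list \<Rightarrow> bool" where
  "stack s r q \<longleftrightarrow> walk r q (s ''x'' 0) \<and> s ''tp'' 0 = 1 + int (length q) \<and>
     (\<forall>i\<le>length q. s ''stk'' (1 + int i) = (r # map H q) ! i \<and>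
       s ''pos'' ((r # map H q) ! i) = 1 + int i)"

lemma stack_distinct:
  assumes "stack s r q" shows "distinct (r # map H q)"
  unfolding distinct_conv_nth
proof (intro allI impI)
  fix i j assume ij: "i < length (r # map H q)" "j < length (r # map H q)" "i \<noteq> j"
  then have "s ''pos'' ((r # map H q) ! i) = 1 + int i" "s ''pos'' ((r # map H q) ! j) = 1 + int j"
    using assms unfolding stack_def by auto
  then show "(r # map H q) ! i \<noteq> (r # map H q) ! j" using ij(3) by auto
qed

text \<open>If \<open>H e\<close> is on the stack, the arcs after it together with \<open>e\<close>
  form a dicycle; its weight 1 leaves the walk and is credited to \<open>z\<close> as
  \<open>d\<close>. Otherwise \<open>e\<close> is appended. Either way the balance changes by the
  defect of \<open>e\<close>.\<close>

lemma stack_step: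
  fixes w :: "int \<Rightarrow> real"
  assumes g: "graph_in s" and w: "index_weighting w" and st: "stack s r q"
    and e: "s ''a'' 0 = e" "arc e" "T e = s ''x'' 0"
  obtains q' where "stack (run step s) r q'"
    "real_of_int (run step s ''z'' 0) + s ''d'' 0 * sum_list (map w q') =
     s ''z'' 0 + s ''d'' 0 * sum_list (map w q) + (s ''d'' 0 * w e - s ''g'' e)"
proof -
  note step = run_step[OF g e(1,2)]
  let ?p = "s ''pos'' (H e)" and ?vs = "r # map H q"
  have q: "walk r q (s ''x'' 0)" and tp: "s ''tp'' 0 = 1 + int (length q)"
    and cells: "\<And>i. i \<le> length q \<Longrightarrow> s ''stk'' (1 + int i) = ?vs ! i \<and> s ''pos'' (?vs ! i) = 1 + int i"
    using st by (auto simp: stack_def)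
  show ?thesis
  proof (cases "0 < ?p \<and> ?p \<le> s ''tp'' 0 \<and> s ''stk'' ?p = H e")
    case True
    define i where "i = nat (?p - 1)"
    have i: "?p = 1 + int i" "i \<le> length q" using True tp by (auto simp: i_def)
    then have vi: "?vs ! i = H e" using cells[OF i(2)] True by simp
    let ?c = "drop i q @ [e]"
    have "walk (?vs ! i) (drop i q) (s ''x'' 0)" by (rule walk_drop[OF q i(2)])
    then have "walk (H e) ?c (H e)" using e vi by (auto simp: walk_append)
    moreover have "distinct (map H ?c)"
    proof -
      have "drop i ?vs = ?vs ! i # drop (Suc i) ?vs" using i by (intro Cons_nth_drop_Suc[symmetric]) auto
      then have "distinct (H e # map H (drop i q))"
        using distinct_drop[OF stack_distinct[OF st], of i] vi by (simp add: drop_map)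
      then show ?thesis by auto
    qed
    ultimately have "dicycle ?c" unfolding dicycle_def by blast
    then have c: "sum_list (map w (drop i q)) + w e = 1" using w by (auto simp: index_weighting_def)
    have "sum_list (map w q) = sum_list (map w (take i q)) + sum_list (map w (drop i q))"
      by (metis append_take_drop_id map_append sum_list_append)
    then have sum: "sum_list (map w q) + w e = sum_list (map w (take i q)) + 1" using c by simp
    have "stack (run step s) r (take i q)" unfolding stack_def
    proof (intro conjI allI impI)
      show "walk r (take i q) (run step s ''x'' 0)"
        using walk_take[OF q i(2)] vi step(1) by simp
      show "run step s ''tp'' 0 = 1 + int (length (take i q))" using step(3) True i by auto
      fix k assume k: "k \<le> length (take i q)"
      then have "(r # map H (take i q)) ! k = ?vs ! k" by (cases k) auto
      then show "run step s ''stk'' (1 + int k) = (r # map H (take i q)) ! k"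
        "run step s ''pos'' ((r # map H (take i q)) ! k) = 1 + int k"
        using step(4,5) True cells[of k] k by auto
    qed
    moreover have "real_of_int (run step s ''z'' 0) + s ''d'' 0 * sum_list (map w (take i q)) =
        s ''z'' 0 + s ''d'' 0 * sum_list (map w q) + (s ''d'' 0 * w e - s ''g'' e)"
    proof -
      have "s ''d'' 0 * (sum_list (map w q) + w e) = s ''d'' 0 * (sum_list (map w (take i q)) + 1)"
        using sum by simp
      then show ?thesis using step(2) True by (simp add: algebra_simps)
    qed
    ultimately show ?thesis by (rule that)
  next
    case False
    \<comment> \<open>A vertex on the stack would pass the test by the invariant. So failure, be it
      at a fresh or a stale entry of \<open>pos\<close>, means that \<open>H e\<close> is
      new.\<close>
    have new: "?vs ! i \<noteq> H e" if "i \<le> length q" for i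
    proof
      assume vi: "?vs ! i = H e"
      then have "?p = 1 + int i" "s ''stk'' ?p = H e" using cells[OF that] by auto
      then show False using False tp that by auto
    qed
    have "stack (run step s) r (q @ [e])" unfolding stack_def
    proof (intro conjI allI impI)
      show "walk r (q @ [e]) (run step s ''x'' 0)" using q e step(1) by (auto simp: walk_append)
      show "run step s ''tp'' 0 = 1 + int (length (q @ [e]))" using step(3) False tp by auto
      fix k assume k: "k \<le> length (q @ [e])"
      have "run step s ''stk'' (1 + int k) = (r # map H (q @ [e])) ! k \<and>
        run step s ''pos'' ((r # map H (q @ [e])) ! k) = 1 + int k"
      proof (cases "k = length (q @ [e])")
        case True
        then have "(r # map H (q @ [e])) ! k = H e" by (simp add: nth_append)
        then show ?thesis using step(4,5) False tp True by auto
      next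
        case kq: False
        then have k': "k \<le> length q" using k by simp
        then have "(r # map H (q @ [e])) ! k = ?vs ! k" by (cases k) (auto simp: nth_append)
        then show ?thesis using step(4,5) False tp cells[OF k'] new[OF k'] k' by auto
      qed
      then show "run step s ''stk'' (1 + int k) = (r # map H (q @ [e])) ! k"
        "run step s ''pos'' ((r # map H (q @ [e])) ! k) = 1 + int k" by auto
    qed
    moreover have "real_of_int (run step s ''z'' 0) + s ''d'' 0 * sum_list (map w (q @ [e])) =
        s ''z'' 0 + s ''d'' 0 * sum_list (map w q) + (s ''d'' 0 * w e - s ''g'' e)"
      using step(2) False by (auto simp: algebra_simps)
    ultimately show ?thesis by (rule that)
  qed
qed

text \<open>
  The defect of a walk is its weight under \<open>d w - g\<close>. Since \<open>w\<close> is 1 on the erased dicycles, \<open>z\<close>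
  falls short of the defect of the walk so far only by \<open>d w\<close> of the loop-erased walk, which is
  empty once the walk has returned to \<open>r\<close>.
\<close>

definition defect :: "(int \<Rightarrow> real) \<Rightarrow> store \<Rightarrow> int \<Rightarrow> real" where
  "defect w s e = s ''d'' 0 * w e - s ''g'' e"

definition tracks :: "(int \<Rightarrow> real) \<Rightarrow> store \<Rightarrow> int \<Rightarrow> real \<Rightarrow> bool" where
  "tracks w s r c \<longleftrightarrow> (\<exists>q. stack s r q \<and> s ''z'' 0 + s ''d'' 0 * sum_list (map w q) = c)"

lemma defect_cong: "s' ''d'' = s ''d'' \<Longrightarrow> s' ''g'' = s ''g'' \<Longrightarrow> defect w s' = defect w s"
  by (rule ext) (simp add: defect_def)

lemma tracks_cong:
  assumes "\<And>b. b \<in> {''x'', ''tp'', ''stk'', ''pos'', ''z'', ''d''} \<Longrightarrow> s' b = s b"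
  shows "tracks w s' r c \<longleftrightarrow> tracks w s r c"
  using assms by (simp add: tracks_def stack_def)

lemma tracks_step:
  assumes "graph_in s" "index_weighting w" "tracks w s r c"
    and "s ''a'' 0 = e" "arc e" "T e = s ''x'' 0"
  shows "tracks w (run step s) r (c + defect w s e)" "run step s ''x'' 0 = H e"
proof -
  obtain q where q: "stack s r q" "s ''z'' 0 + s ''d'' 0 * sum_list (map w q) = c"
    using assms(3) by (auto simp: tracks_def)
  obtain q' where q': "stack (run step s) r q'"
    "real_of_int (run step s ''z'' 0) + s ''d'' 0 * sum_list (map w q') =
     s ''z'' 0 + s ''d'' 0 * sum_list (map w q) + (s ''d'' 0 * w e - s ''g'' e)"
    using stack_step[OF assms(1,2) q(1) assms(4-6)] by metis
  have "run step s ''d'' = s ''d''" by (simp add: run_frame)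
  then show "tracks w (run step s) r (c + defect w s e)"
    using q q' by (auto simp: tracks_def defect_def)
  show "run step s ''x'' 0 = H e" by (rule run_step(1)[OF assms(1,4,5)])
qed

text \<open>\<open>start\<close> keeps \<open>z\<close>, so a second walk can count on from the
  negated result of the first.\<close>

lemma tracks_start:
  assumes "s ''r'' 0 = r"
  shows "tracks w (run start s) r (s ''z'' 0)" "run start s ''x'' 0 = r"
proof -
  have "stack (run start s) r []" "run start s ''z'' 0 = s ''z'' 0"
    using assms by (auto simp: stack_def start_def upd_same)
  then show "tracks w (run start s) r (s ''z'' 0)" unfolding tracks_def by (intro exI[of _ "[]"]) auto
  show "run start s ''x'' 0 = r" using assms by (simp add: start_def upd_same)
qed

text \<open>The loop-erased walk starts and ends in \<open>r\<close> with distinct vertices, hence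
  is empty. The term with the unknown \<open>w\<close> vanishes, and the integer in \<open>z\<close>
  is the tracked real number.\<close>

lemma tracks_return:
  assumes "tracks w s r c" "s ''x'' 0 = r" shows "real_of_int (s ''z'' 0) = c"
proof -
  obtain q where q: "stack s r q" "s ''z'' 0 + s ''d'' 0 * sum_list (map w q) = c"
    using assms by (auto simp: tracks_def)
  have "r = last (r # map H q)" using walk_last q(1) assms(2) by (auto simp: stack_def)
  then have "q = []" using stack_distinct[OF q(1)] last_in_set[of "map H q"]
    by (cases "map H q = []") auto
  then show ?thesis using q by simp
qed

text \<open>\<open>p0\<close> witnesses that \<open>t\<close> is reachable; the walk actually taken
  is the one stored in \<open>nx\<close>.\<close>

lemma tracks_walk_to:
  assumes g: "graph_in s" and w: "index_weighting w" and tr: "tracks w s r c"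
    and t: "val b s = t" and reach: "reach_ok s t" "vert (s ''x'' 0)" "walk (s ''x'' 0) p0 t"
  defines "s' \<equiv> run (walk_to b) s"
  shows "tracks w s' r (c + sum_list (map (defect w s) (path (s ''nx'') (s ''x'' 0) t)))"
    "s' ''x'' 0 = t"
proof -
  define p where "p = path (s ''nx'') (s ''x'' 0) t"
  note p = path[OF reach, folded p_def]
  let ?c = "if_eq (var ''x'') (var ''y'') Halt
       (set_var ''a'' (Read ''nx'' (cell_exp (var ''y'') (var ''x''))) ;; step)"
  define s1 where "s1 = upd ''y'' 0 t s"
  define h where "h = (\<lambda>p. sum_list (map (defect w s) p))"
  \<comment> \<open>\<open>p'\<close> is the part of the chosen walk still to go. Truncated
    subtraction covers the idle rounds, and since \<open>p\<close> has at most \<open>n\<close> arcs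
    nothing is left after \<open>n\<close> rounds.\<close>
  define P where "P j s' \<longleftrightarrow> (\<exists>p'. follow (row ''nx'' s t) t (s' ''x'' 0) p' \<and>
    length p' \<le> length p - j \<and> tracks w s' r (c + h p - h p'))" for j s'
  have "P (nat n) (run (For ''j'' 1 ?c) s1)"
  proof (rule run_For_invariant)
    have "tracks w s1 r c" using tr by (subst tracks_cong[of _ s]) (auto simp: s1_def)
    then have "tracks w (upd ''j'' 0 0 s1) r c" by (subst tracks_cong[of _ s1]) auto
    then show "P 0 (upd ''j'' 0 0 s1)" using p by (auto simp: P_def s1_def intro!: exI[of _ p])
    show "nat n = nat (s1 ''in'' 1)" using g by (simp add: graph_in_def s1_def)
    fix j s'
    assume fr: "\<And>x. x \<noteq> ''j'' \<Longrightarrow> x \<notin> writes ?c \<Longrightarrow> s' x = s1 x" and P: "P j s'"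
    have fr': "s' ''in'' = s ''in''" "s' ''nx'' = s ''nx''" "s' ''d'' = s ''d''" "s' ''g'' = s ''g''"
      "s' ''y'' 0 = t"
      using fr by (simp_all add: s1_def upd_same)
    obtain p' where p': "follow (row ''nx'' s t) t (s' ''x'' 0) p'" "length p' \<le> length p - j"
      "tracks w s' r (c + h p - h p')" using P by (auto simp: P_def)
    have "\<exists>p'. follow (row ''nx'' s t) t (run ?c s' ''x'' 0) p' \<and>
      length p' \<le> length p - Suc j \<and> tracks w (run ?c s') r (c + h p - h p')"
    proof (cases p')
      case Nil
      then have eq: "run ?c s' = s'" using p' fr' by simp
      show ?thesis unfolding eq using p' Nil by (intro exI[of _ "[]"]) auto
    next
      case (Cons e p'')
      then have e: "s' ''x'' 0 \<noteq> t" "row ''nx'' s t (s' ''x'' 0) = e" "arc e" "T e = s' ''x'' 0"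
        and p'': "follow (row ''nx'' s t) t (H e) p''" using p'(1) by auto
      define s2 where "s2 = upd ''a'' 0 e s'"
      have n: "s' ''in'' 1 = n" using g fr' by (simp add: graph_in_def)
      have r: "run ?c s' = run step s2" using e n fr' by (simp add: s2_def)
      have g2: "graph_in s2" using g fr' by (subst graph_in_cong[of _ s]) (auto simp: s2_def)
      have tr2: "tracks w s2 r (c + h p - h p')"
        using p'(3) by (subst tracks_cong[of _ s']) (auto simp: s2_def)
      have "tracks w (run step s2) r (c + h p - h p' + defect w s2 e)" "run step s2 ''x'' 0 = H e"
        by (rule tracks_step[OF g2 w tr2]; use e in \<open>simp add: s2_def upd_same\<close>)+
      moreover have "defect w s2 = defect w s" using fr' by (intro defect_cong) (auto simp: s2_def)
      ultimately have "tracks w (run ?c s') r (c + h p - h p'')" "run ?c s' ''x'' 0 = H e"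
        unfolding r using Cons by (auto simp: h_def algebra_simps)
      then show ?thesis using p'' p'(2) Cons by (intro exI[of _ p'']) auto
    qed
    then obtain p1 where p1: "follow (row ''nx'' s t) t (run ?c s' ''x'' 0) p1"
      "length p1 \<le> length p - Suc j" "tracks w (run ?c s') r (c + h p - h p1)" by blast
    have "tracks w (upd ''j'' 0 (int (Suc j)) (run ?c s')) r (c + h p - h p1)"
      using p1(3) by (subst tracks_cong[of _ "run ?c s'"]) auto
    then show "P (Suc j) (upd ''j'' 0 (int (Suc j)) (run ?c s'))"
      using p1 unfolding P_def by (intro exI[of _ p1]) (simp del: run.simps if_eq_simps)
  qed auto
  moreover have "s' = run (For ''j'' 1 ?c) s1" using t by (simp add: s'_def walk_to_def s1_def)
  ultimately obtain p' where p': "follow (row ''nx'' s t) t (s' ''x'' 0) p'"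
    "length p' \<le> length p - nat n" "tracks w s' r (c + h p - h p')" by (auto simp: P_def)
  have "p' = []" using p'(2) p(2) n_nonneg by auto
  then show "tracks w s' r (c + sum_list (map (defect w s) (path (s ''nx'') (s ''x'' 0) t)))"
    "s' ''x'' 0 = t"
    using p' by (auto simp: h_def p_def)
qed

end

section \<open>Potentials, shifted defects and the comparison of closed walks\<close>

context index_digraph
begin

text \<open>The potential of the overview with defects in place of weights; for \<open>d = 1\<close>
  and \<open>g = 0\<close> the two coincide.\<close>

definition potential :: "(int \<Rightarrow> real) \<Rightarrow> store \<Rightarrow> int \<Rightarrow> int \<Rightarrow> real" where
  "potential w s r x = sum_list (map (defect w s) (path (s ''nx'') r x))"

definition shifted_defect :: "(int \<Rightarrow> real) \<Rightarrow> store \<Rightarrow> int \<Rightarrow> int \<Rightarrow> real" where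
  "shifted_defect w s r e = defect w s e + potential w s r (T e) - potential w s r (H e)"

lemma potential_cong:
  assumes "s' ''nx'' = s ''nx''" "s' ''d'' = s ''d''" "s' ''g'' = s ''g''"
  shows "potential w s' = potential w s" "shifted_defect w s' = shifted_defect w s"
  by (intro ext; simp add: potential_def shifted_defect_def assms defect_cong[OF assms(2,3)])+

lemma reach_ok_frame: "s' ''rc'' = s ''rc'' \<Longrightarrow> s' ''nx'' = s ''nx'' \<Longrightarrow> reach_ok s' t = reach_ok s t"
  by (simp add: reach_ok_def)

text \<open>Both closed walks end with the same chosen walk from \<open>H e\<close> to
  \<open>r\<close>, which cancels in the difference. What remains is \<open>e\<close> and the chosen
  walks from \<open>r\<close> to its two ends, whose defects are the potentials.\<close>

lemma run_compare_walks:
  assumes g: "graph_in s" and w: "index_weighting w"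
    and tables: "\<And>t. vert t \<Longrightarrow> reach_ok s t"
    and r: "s ''r'' 0 = r" "vert r" and e: "s ''e'' 0 = e" "arc e"
    and uv: "s ''u'' 0 = T e" "s ''v'' 0 = H e" and linked: "linked r e"
  shows "real_of_int (run compare_walks s ''z'' 0) = shifted_defect w s r e"
proof -
  obtain pu pv where pu: "walk r pu (T e)" and pv: "walk (H e) pv r"
    using linked by (auto simp: linked_def)
  then have prv: "walk r (pu @ [e]) (H e)" using e by (auto simp: walk_append)
  have vu: "vert (T e)" "vert (H e)" using T_range[of e] H_range[of e] e by auto
  let ?fixed = "\<lambda>s'. s' ''in'' = s ''in'' \<and> s' ''rc'' = s ''rc'' \<and> s' ''nx'' = s ''nx'' \<and>
    s' ''d'' = s ''d'' \<and> s' ''g'' = s ''g'' \<and> s' ''r'' = s ''r'' \<and> s' ''e'' = s ''e'' \<and>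
    s' ''u'' = s ''u'' \<and> s' ''v'' = s ''v''"
  have fixed: "graph_in s'" "\<And>t. vert t \<Longrightarrow> reach_ok s' t" "defect w s' = defect w s"
    "s' ''r'' 0 = r" "s' ''e'' 0 = e" "s' ''u'' 0 = T e" "s' ''v'' 0 = H e" "s' ''nx'' = s ''nx''"
    if "?fixed s'" for s'
    using that g tables r e uv graph_in_cong[of s' s] reach_ok_frame[of s' s]
      defect_cong[of s' s w] by auto
  note frame = run_frame
  let ?h = "\<lambda>p. sum_list (map (defect w s) p)"
  let ?A = "\<lambda>x t. ?h (path (s ''nx'') x t)"
  define s1 where "s1 = run start (upd ''z'' 0 0 s)"
  define s2 where "s2 = run (walk_to (var ''v'')) s1"
  define s3 where "s3 = run (walk_to (var ''r'')) s2"
  define s4 where "s4 = upd ''z'' 0 (- s3 ''z'' 0) s3"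
  define s5 where "s5 = run start s4"
  define s6 where "s6 = run (walk_to (var ''u'')) s5"
  define s7 where "s7 = upd ''a'' 0 e s6"
  define s8 where "s8 = run step s7"
  define s9 where "s9 = run (walk_to (var ''r'')) s8"
  have f1: "?fixed s1" by (simp add: s1_def frame)
  have f2: "?fixed s2" using f1 by (simp add: s2_def frame)
  have f3: "?fixed s3" using f2 by (simp add: s3_def frame)
  have f4: "?fixed s4" using f3 by (simp add: s4_def)
  have f5: "?fixed s5" using f4 by (simp add: s5_def frame)
  have f6: "?fixed s6" using f5 by (simp add: s6_def frame)
  have f7: "?fixed s7" using f6 by (simp add: s7_def)
  have f8: "?fixed s8" using f7 by (simp add: s8_def frame)
  have run_eq: "run compare_walks s = s9"
    using fixed(5)[OF f6]
    by (simp add: compare_walks_def arc_step_def s1_def s2_def s3_def s4_def s5_def s6_def s7_def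
        s8_def s9_def)
  have t1: "tracks w s1 r 0" "s1 ''x'' 0 = r"
    using tracks_start[of "upd ''z'' 0 0 s" r] r by (simp_all add: s1_def upd_same)
  have t2: "tracks w s2 r (0 + ?A r (H e))" "s2 ''x'' 0 = H e"
    using tracks_walk_to[OF fixed(1)[OF f1] w t1(1), of "var ''v''" "H e" "pu @ [e]"]
      fixed(2)[OF f1] t1(2) r(2) vu prv fixed(3,7,8)[OF f1] by (auto simp: s2_def)
  have t3: "tracks w s3 r (0 + ?A r (H e) + ?A (H e) r)" "s3 ''x'' 0 = r"
    using tracks_walk_to[OF fixed(1)[OF f2] w t2(1), of "var ''r''" r pv]
      fixed(2)[OF f2] t2(2) r(2) vu pv fixed(3,4,8)[OF f2] by (auto simp: s3_def)
  have z3: "real_of_int (s3 ''z'' 0) = ?A r (H e) + ?A (H e) r"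
    using tracks_return[OF t3] by simp
  have t5: "tracks w s5 r (- (?A r (H e) + ?A (H e) r))" "s5 ''x'' 0 = r"
    using tracks_start[of s4 r] fixed(4)[OF f4] z3 by (simp_all add: s5_def s4_def upd_same)
  have t6: "tracks w s6 r (- (?A r (H e) + ?A (H e) r) + ?A r (T e))" "s6 ''x'' 0 = T e"
    using tracks_walk_to[OF fixed(1)[OF f5] w t5(1), of "var ''u''" "T e" pu]
      fixed(2)[OF f5] t5(2) r(2) vu pu fixed(3,6,8)[OF f5] by (auto simp: s6_def)
  have "tracks w s7 r (- (?A r (H e) + ?A (H e) r) + ?A r (T e))"
    using t6(1) by (subst tracks_cong[of _ s6]) (auto simp: s7_def)
  from tracks_step[OF fixed(1)[OF f7] w this, of e]
  have t8: "tracks w s8 r (- (?A r (H e) + ?A (H e) r) + ?A r (T e) + defect w s e)"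
    "s8 ''x'' 0 = H e"
    using t6(2) e fixed(3)[OF f7] by (auto simp: s8_def s7_def upd_same)
  have t9: "tracks w s9 r (- (?A r (H e) + ?A (H e) r) + ?A r (T e) + defect w s e + ?A (H e) r)"
    "s9 ''x'' 0 = r"
    using tracks_walk_to[OF fixed(1)[OF f8] w t8(1), of "var ''r''" r pv]
      fixed(2)[OF f8] t8(2) r(2) vu pv fixed(3,4,8)[OF f8] by (auto simp: s9_def)
  have "real_of_int (s9 ''z'' 0) = defect w s e + ?A r (T e) - ?A r (H e)"
    using tracks_return[OF t9] by simp
  then show ?thesis by (simp add: run_eq shifted_defect_def potential_def)
qed

text \<open>The state \<open>s1\<close> in which \<open>fin\<close> starts is realised as the
  outcome of the same program with \<open>Halt\<close> for \<open>fin\<close>, so one statement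
  serves both loops.\<close>

lemma run_process:
  assumes g: "graph_in s" and w: "index_weighting w"
    and tables: "\<And>t. vert t \<Longrightarrow> reach_ok s t"
    and r: "s ''r'' 0 = r" "vert r" and e: "s ''e'' 0 = e" "arc e"
  obtains s1 where "run (process fin) s = (if linked r e then run fin s1 else s1)"
    "\<And>x. x \<notin> writes (process Halt) \<Longrightarrow> s1 x = s x"
    "linked r e \<Longrightarrow> real_of_int (s1 ''z'' 0) = shifted_defect w s r e"
proof -
  define s0 where "s0 = upd ''v'' 0 (H e) (upd ''u'' 0 (T e) s)"
  have n: "s ''in'' 1 = n" using g by (simp add: graph_in_def)
  have T: "s ''in'' (3 + (n + (e + e))) = T e" and H: "s ''in'' (4 + (n + (e + e))) = H e"
    using g e by (simp_all add: graph_in_def)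
  have vu: "vert (T e)" "vert (H e)" using T_range[of e] H_range[of e] e by auto
  have same: "s0 x = s x" if "x \<noteq> ''u''" "x \<noteq> ''v''" for x using that by (simp add: s0_def)
  have g0: "graph_in s0" using g by (subst graph_in_cong[of _ s]) (auto simp: s0_def)
  have tab0: "reach_ok s0 t" if "vert t" for t
    using tables[OF that] by (subst reach_ok_frame[of _ s]) (auto simp: s0_def)
  have lk: "linked r e \<longleftrightarrow> row ''rc'' s (T e) r > 0 \<and> row ''rc'' s r (H e) > 0"
    unfolding linked_def using reach_ok_iff tables vu r by simp
  have run0: "run (process fin) s =
      (if linked r e then run fin (run compare_walks s0) else s0)" for fin
    unfolding process_def lk using n T H T[simplified] H[simplified] r e
    by (auto simp: s0_def upd_same)
  show ?thesis
  proof (rule that[of "run (process Halt) s"])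
    show "run (process fin) s =
      (if linked r e then run fin (run (process Halt) s) else run (process Halt) s)"
      by (simp add: run0)
    show "\<And>x. x \<notin> writes (process Halt) \<Longrightarrow> run (process Halt) s x = s x" by (rule run_frame)
    assume l: "linked r e"
    have "real_of_int (run compare_walks s0 ''z'' 0) = shifted_defect w s0 r e"
      by (rule run_compare_walks[OF g0 w tab0 _ r(2) _ e(2) _ _ l]) (use r e in \<open>auto simp: s0_def upd_same\<close>)
    moreover have "shifted_defect w s0 = shifted_defect w s"
      by (rule potential_cong) (auto simp: s0_def)
    ultimately show "real_of_int (run (process Halt) s ''z'' 0) = shifted_defect w s r e"
      using l by (simp add: run0)
  qed
qed

lemma sum_shifted_defect:
  assumes "dicycle C"
  shows "(\<Sum>e\<leftarrow>C. shifted_defect w s r e) = sum_list (map (defect w s) C)"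
proof -
  obtain x where "walk x C x" using assms by (auto simp: dicycle_def)
  from walk_telescope[OF this, of "defect w s" "potential w s r"]
  show ?thesis by (simp add: shifted_defect_def)
qed

text \<open>The right-hand side is free of \<open>w\<close>: it is 1 for \<open>d = 1\<close> and
  \<open>g = 0\<close>, and \<open>d (1 - f(C))\<close> for \<open>g = d f\<close>.\<close>

lemma sum_defect:
  assumes "dicycle C" "index_weighting w"
  shows "sum_list (map (defect w s) C) = s ''d'' 0 - (\<Sum>e\<leftarrow>C. real_of_int (s ''g'' e))"
proof -
  have "sum_list (map (defect w s) C) =
    s ''d'' 0 * sum_list (map w C) - (\<Sum>e\<leftarrow>C. real_of_int (s ''g'' e))"
    unfolding defect_def by (simp add: sum_list_subtractf sum_list_const_mult)
  then show ?thesis using assms by (simp add: index_weighting_def)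
qed

end

subsection \<open>Finding a weighting\<close>

text \<open>The numerator of arc \<open>e\<close> goes to cell 1 + 2 e. A root overwrites the values
  of its whole strong component; arcs between different components keep the initial 0.\<close>

definition find_loop :: prog where
  "find_loop = For ''r'' 1 (For ''e'' 2 (process
     (Assign ''out'' (Plus (Const 1) (Plus (var ''e'') (var ''e''))) (var ''z''))))"

lemma writes_find_loop [simp]: "writes find_loop =
    {''r'', ''e'', ''out'', ''u'', ''v'', ''y'', ''j'', ''a'', ''z'', ''x'', ''tp'', ''stk'', ''pos''}"
  and tame_find_loop [simp]: "tame find_loop"
  by (auto simp: find_loop_def)

context index_digraph
begin

lemma run_find_row:
  assumes g: "graph_in s" and w: "index_weighting w"
    and tables: "\<And>t. vert t \<Longrightarrow> reach_ok s t" and r: "s ''r'' 0 = r" "vert r" and e: "arc e"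
  shows "real_of_int (run (For ''e'' 2 (process
       (Assign ''out'' (Plus (Const 1) (Plus (var ''e'') (var ''e''))) (var ''z'')))) s ''out'' (1 + (e + e))) =
    (if linked r e then shifted_defect w s r e else s ''out'' (1 + (e + e)))"
proof -
  let ?fin = "Assign ''out'' (Plus (Const 1) (Plus (var ''e'') (var ''e''))) (var ''z'')"
  define P where "P j s' \<longleftrightarrow> (\<forall>e. arc e \<longrightarrow> real_of_int (s' ''out'' (1 + (e + e))) =
    (if e < int j \<and> linked r e then shifted_defect w s r e else s ''out'' (1 + (e + e))))"
    for j :: nat and s' :: store
  have "P (nat m) (run (For ''e'' 2 (process ?fin)) s)"
  proof (rule run_For_invariant)
    show "P 0 (upd ''e'' 0 0 s)" by (auto simp: P_def)
    show "nat m = nat (s ''in'' 2)" using g by (simp add: graph_in_def)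
    fix j s'
    assume j: "j < nat m" "s' ''e'' 0 = int j" and P: "P j s'"
      and fr: "\<And>x. x \<noteq> ''e'' \<Longrightarrow> x \<notin> writes (process ?fin) \<Longrightarrow> s' x = s x"
    have g': "graph_in s'" using g fr by (subst graph_in_cong[of _ s]) auto
    have tab': "reach_ok s' t" if "vert t" for t
      using tables[OF that] fr by (subst reach_ok_frame[of _ s]) auto
    have r': "s' ''r'' 0 = r" using r fr by simp
    have a: "arc (int j)" using j by auto
    have sd: "shifted_defect w s' = shifted_defect w s" by (rule potential_cong) (use fr in auto)
    obtain s1 where s1: "run (process ?fin) s' = (if linked r (int j) then run ?fin s1 else s1)"
      "\<And>x. x \<notin> writes (process Halt) \<Longrightarrow> s1 x = s' x"
      "linked r (int j) \<Longrightarrow> real_of_int (s1 ''z'' 0) = shifted_defect w s r (int j)"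
      using run_process[OF g' w tab' r' r(2) j(2) a, unfolded sd] by blast
    have "s1 ''e'' 0 = int j" "s1 ''out'' = s' ''out''" using s1(2) j(2) by simp_all
    then have out: "run (process ?fin) s' ''out'' (1 + (e + e)) =
        (if e = int j \<and> linked r e then s1 ''z'' 0 else s' ''out'' (1 + (e + e)))" for e
      using s1(1) by (auto simp: upd_same)
    have "P (Suc j) (run (process ?fin) s')" unfolding P_def
    proof (intro allI impI)
      fix e assume "arc e"
      then show "real_of_int (run (process ?fin) s' ''out'' (1 + (e + e))) =
          (if e < int (Suc j) \<and> linked r e then shifted_defect w s r e else s ''out'' (1 + (e + e)))"
        using P s1(3) unfolding out by (cases "e = int j") (auto simp: P_def)
    qed
    then show "P (Suc j) (upd ''e'' 0 (int (Suc j)) (run (process ?fin) s'))"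
      by (simp add: P_def)
  qed auto
  then show ?thesis using e by (simp add: P_def)
qed

text \<open>After \<open>j\<close> roots the values sum to 1 on every dicycle with a vertex below
  \<open>j\<close>. The pass for \<open>j\<close> either replaces all values on a dicycle by shifted
  defects for one root, with sum 1, or replaces none; then \<open>j\<close> is not on the dicycle
  and the old sum persists.\<close>

lemma run_find_loop:
  assumes g: "graph_in s" and w: "index_weighting w" and tables: "\<And>t. vert t \<Longrightarrow> reach_ok s t"
    and d: "s ''d'' 0 = 1" and gz: "\<And>e. s ''g'' e = 0"
  shows "index_weighting (\<lambda>e. real_of_int (run find_loop s ''out'' (1 + (e + e))))"
proof -
  let ?c = "For ''e'' 2 (process
     (Assign ''out'' (Plus (Const 1) (Plus (var ''e'') (var ''e''))) (var ''z'')))"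
  define P where "P j s' \<longleftrightarrow> (\<forall>C. dicycle C \<longrightarrow> (\<exists>e\<in>set C. T e < int j) \<longrightarrow>
    (\<Sum>e\<leftarrow>C. real_of_int (s' ''out'' (1 + (e + e)))) = 1)" for j :: nat and s' :: store
  have "P (nat n) (run find_loop s)" unfolding find_loop_def
  proof (rule run_For_invariant)
    show "P 0 (upd ''r'' 0 0 s)" using dicycle_arc T_range by (force simp: P_def)
    show "nat n = nat (s ''in'' 1)" using g by (simp add: graph_in_def)
    fix j s'
    assume j: "j < nat n" "s' ''r'' 0 = int j" and P: "P j s'"
      and fr: "\<And>x. x \<noteq> ''r'' \<Longrightarrow> x \<notin> writes ?c \<Longrightarrow> s' x = s x"
    have g': "graph_in s'" using g fr by (subst graph_in_cong[of _ s]) auto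
    have tab': "reach_ok s' t" if "vert t" for t
      using tables[OF that] fr by (subst reach_ok_frame[of _ s]) auto
    have r: "vert (int j)" using j by auto
    note row = run_find_row[OF g' w tab' j(2) r]
    have "P (Suc j) (run ?c s')" unfolding P_def
    proof (intro allI impI)
      fix C assume C: "dicycle C" "\<exists>e\<in>set C. T e < int (Suc j)"
      have arcs: "arc e" if "e \<in> set C" for e using dicycle_arc[OF C(1) that] .
      show "(\<Sum>e\<leftarrow>C. real_of_int (run ?c s' ''out'' (1 + (e + e)))) = 1"
      proof (cases "\<exists>e\<in>set C. linked (int j) e")
        case True
        then have l: "linked (int j) e" if "e \<in> set C" for e
          using linked_dicycle[OF C(1) _ that] by blast
        have "map (\<lambda>e. real_of_int (run ?c s' ''out'' (1 + (e + e)))) C =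
            map (shifted_defect w s' (int j)) C"
          by (rule map_cong) (use row arcs l in simp_all)
        then have "(\<Sum>e\<leftarrow>C. real_of_int (run ?c s' ''out'' (1 + (e + e)))) =
            s' ''d'' 0 - (\<Sum>e\<leftarrow>C. real_of_int (s' ''g'' e))"
          using sum_shifted_defect[OF C(1)] sum_defect[OF C(1) w] by metis
        moreover have "s' ''d'' 0 = 1" "\<And>e. s' ''g'' e = 0" using fr d gz by simp_all
        ultimately show ?thesis by simp
      next
        case False
        have "T e \<noteq> int j" if "e \<in> set C" for e using linked_tail[OF C(1) that] False that by auto
        then have "\<exists>e\<in>set C. T e < int j" using C(2) by force
        then have "(\<Sum>e\<leftarrow>C. real_of_int (s' ''out'' (1 + (e + e)))) = 1"
          using P C(1) by (simp add: P_def)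
        moreover have "map (\<lambda>e. real_of_int (run ?c s' ''out'' (1 + (e + e)))) C =
            map (\<lambda>e. real_of_int (s' ''out'' (1 + (e + e)))) C"
          by (rule map_cong) (use row arcs False in simp_all)
        ultimately show ?thesis by metis
      qed
    qed
    then show "P (Suc j) (upd ''r'' 0 (int (Suc j)) (run ?c s'))" by (simp add: P_def)
  qed auto
  then show ?thesis unfolding index_weighting_def P_def
  proof (intro allI impI)
    fix C assume all: "\<forall>C. dicycle C \<longrightarrow> (\<exists>e\<in>set C. T e < int (nat n)) \<longrightarrow>
      (\<Sum>e\<leftarrow>C. real_of_int (run find_loop s ''out'' (1 + (e + e)))) = 1" and C: "dicycle C"
    then obtain e where e: "e \<in> set C" by (cases C) (auto simp: dicycle_def)
    then have "T e < int (nat n)" using dicycle_arc[OF C e] T_range[of e] by auto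
    then show "(\<Sum>e\<leftarrow>C. real_of_int (run find_loop s ''out'' (1 + (e + e)))) = 1"
      using all C e by blast
  qed
qed

end

subsection \<open>Testing a weighting\<close>

definition test_loop :: prog where
  "test_loop = For ''r'' 1 (For ''e'' 2 (process
     (if_eq (var ''z'') (Const 0) Halt (set_var ''bad'' (Const 1)))))"

lemma writes_test_loop [simp]: "writes test_loop =
    {''r'', ''e'', ''bad'', ''u'', ''v'', ''y'', ''j'', ''a'', ''z'', ''x'', ''tp'', ''stk'', ''pos''}"
  and tame_test_loop [simp]: "tame test_loop"
  by (auto simp: test_loop_def)

context index_digraph
begin

lemma run_test_row:
  assumes g: "graph_in s" and w: "index_weighting w"
    and tables: "\<And>t. vert t \<Longrightarrow> reach_ok s t" and r: "s ''r'' 0 = r" "vert r"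
  shows "run (For ''e'' 2 (process
     (if_eq (var ''z'') (Const 0) Halt (set_var ''bad'' (Const 1))))) s ''bad'' 0 =
    (if \<exists>e. arc e \<and> linked r e \<and> shifted_defect w s r e \<noteq> 0 then 1 else s ''bad'' 0)"
proof -
  let ?fin = "if_eq (var ''z'') (Const 0) Halt (set_var ''bad'' (Const 1))"
  let ?bad = "\<lambda>e. linked r e \<and> shifted_defect w s r e \<noteq> 0"
  define P where "P j s' \<longleftrightarrow>
    s' ''bad'' 0 = (if \<exists>e. 0 \<le> e \<and> e < int j \<and> ?bad e then 1 else s ''bad'' 0)"
    for j :: nat and s' :: store
  have "P (nat m) (run (For ''e'' 2 (process ?fin)) s)"
  proof (rule run_For_invariant)
    show "P 0 (upd ''e'' 0 0 s)" by (auto simp: P_def)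
    show "nat m = nat (s ''in'' 2)" using g by (simp add: graph_in_def)
    fix j s'
    assume j: "j < nat m" "s' ''e'' 0 = int j" and P: "P j s'"
      and fr: "\<And>x. x \<noteq> ''e'' \<Longrightarrow> x \<notin> writes (process ?fin) \<Longrightarrow> s' x = s x"
    have g': "graph_in s'" using g fr by (subst graph_in_cong[of _ s]) auto
    have tab': "reach_ok s' t" if "vert t" for t
      using tables[OF that] fr by (subst reach_ok_frame[of _ s]) auto
    have r': "s' ''r'' 0 = r" using r fr by simp
    have a: "arc (int j)" using j by auto
    have sd: "shifted_defect w s' = shifted_defect w s" by (rule potential_cong) (use fr in auto)
    obtain s1 where s1: "run (process ?fin) s' = (if linked r (int j) then run ?fin s1 else s1)"
      "\<And>x. x \<notin> writes (process Halt) \<Longrightarrow> s1 x = s' x"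
      "linked r (int j) \<Longrightarrow> real_of_int (s1 ''z'' 0) = shifted_defect w s r (int j)"
      using run_process[OF g' w tab' r' r(2) j(2) a, unfolded sd] by blast
    have "s1 ''bad'' = s' ''bad''" using s1(2) by simp
    then have bad: "run (process ?fin) s' ''bad'' 0 = (if ?bad (int j) then 1 else s' ''bad'' 0)"
      using s1(1,3) by (auto simp: upd_same)
    have "(\<exists>e. 0 \<le> e \<and> e < int (Suc j) \<and> ?bad e) \<longleftrightarrow>
        (\<exists>e. 0 \<le> e \<and> e < int j \<and> ?bad e) \<or> ?bad (int j)"
    proof -
      have "0 \<le> e \<and> e < int (Suc j) \<and> ?bad e \<longleftrightarrow>
          (0 \<le> e \<and> e < int j \<and> ?bad e) \<or> (e = int j \<and> ?bad e)" for e by auto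
      then show ?thesis by (simp only: ex_disj_distrib) simp
    qed
    then have "P (Suc j) (run (process ?fin) s')" using P bad unfolding P_def by auto
    then show "P (Suc j) (upd ''e'' 0 (int (Suc j)) (run (process ?fin) s'))"
      by (simp add: P_def)
  qed auto
  then show ?thesis using m_nonneg by (simp add: P_def conj_assoc)
qed

lemma run_test_loop:
  assumes g: "graph_in s" and w: "index_weighting w" and tables: "\<And>t. vert t \<Longrightarrow> reach_ok s t"
    and bad0: "s ''bad'' 0 = 0"
  shows "run test_loop s ''bad'' 0 = (if \<exists>r e. vert r \<and> arc e \<and> linked r e \<and>
    shifted_defect w s r e \<noteq> 0 then 1 else 0)"
proof -
  let ?c = "For ''e'' 2 (process (if_eq (var ''z'') (Const 0) Halt (set_var ''bad'' (Const 1))))"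
  define bad where "bad r \<longleftrightarrow> (\<exists>e. arc e \<and> linked r e \<and> shifted_defect w s r e \<noteq> 0)" for r
  define P where "P j s' \<longleftrightarrow> s' ''bad'' 0 = (if \<exists>r. 0 \<le> r \<and> r < int j \<and> bad r then 1 else 0)"
    for j :: nat and s' :: store
  have "P (nat n) (run test_loop s)" unfolding test_loop_def
  proof (rule run_For_invariant)
    show "P 0 (upd ''r'' 0 0 s)" using bad0 by (auto simp: P_def)
    show "nat n = nat (s ''in'' 1)" using g by (simp add: graph_in_def)
    fix j s'
    assume j: "j < nat n" "s' ''r'' 0 = int j" and P: "P j s'"
      and fr: "\<And>x. x \<noteq> ''r'' \<Longrightarrow> x \<notin> writes ?c \<Longrightarrow> s' x = s x"
    have g': "graph_in s'" using g fr by (subst graph_in_cong[of _ s]) auto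
    have tab': "reach_ok s' t" if "vert t" for t
      using tables[OF that] fr by (subst reach_ok_frame[of _ s]) auto
    have r: "vert (int j)" using j by auto
    have sd: "shifted_defect w s' = shifted_defect w s" by (rule potential_cong) (use fr in auto)
    note row = run_test_row[OF g' w tab' j(2) r, unfolded sd]
    have iff: "(\<exists>r. 0 \<le> r \<and> r < int (Suc j) \<and> bad r) \<longleftrightarrow>
        (\<exists>r. 0 \<le> r \<and> r < int j \<and> bad r) \<or> bad (int j)"
    proof -
      have "0 \<le> r \<and> r < int (Suc j) \<and> bad r \<longleftrightarrow>
          (0 \<le> r \<and> r < int j \<and> bad r) \<or> (r = int j \<and> bad r)" for r by auto
      then show ?thesis by (simp only: ex_disj_distrib) simp
    qed
    have prev: "s' ''bad'' 0 = (if \<exists>r. 0 \<le> r \<and> r < int j \<and> bad r then 1 else 0)"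
      using P by (simp only: P_def)
    have "run ?c s' ''bad'' 0 = (if bad (int j) then 1 else s' ''bad'' 0)" unfolding bad_def by (rule row)
    then have "P (Suc j) (run ?c s')" unfolding P_def iff prev by auto
    then show "P (Suc j) (upd ''r'' 0 (int (Suc j)) (run ?c s'))" by (simp add: P_def)
  qed auto
  moreover have "(\<exists>r. 0 \<le> r \<and> r < int (nat n) \<and> bad r) \<longleftrightarrow>
      (\<exists>r e. vert r \<and> arc e \<and> linked r e \<and> shifted_defect w s r e \<noteq> 0)"
    unfolding bad_def using n_nonneg by auto
  ultimately show ?thesis unfolding P_def by simp
qed

text \<open>The potentials are sums of defects along chosen walks, so they vanish with the defects.
  This is why the test accepts weightings.\<close>

lemma shifted_defect_eq_0:
  assumes tables: "\<And>t. vert t \<Longrightarrow> reach_ok s t" and "vert r" "arc e" "linked r e"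
    and zero: "\<And>a. arc a \<Longrightarrow> defect w s a = 0"
  shows "shifted_defect w s r e = 0"
proof -
  have pot: "potential w s r x = 0" if "vert x" "walk r p x" for x p
  proof -
    have "arc a" if "a \<in> set (path (s ''nx'') r x)" for a
      using walk_arcs[OF follow_walk[OF path(1)[OF tables[OF \<open>vert x\<close>] assms(2) \<open>walk r p x\<close>]] that] .
    then have "map (defect w s) (path (s ''nx'') r x) = map (\<lambda>_. 0) (path (s ''nx'') r x)"
      using zero by (intro map_cong) auto
    then have "potential w s r x = (\<Sum>a\<leftarrow>path (s ''nx'') r x. 0)"
      unfolding potential_def by (rule arg_cong)
    then show ?thesis by simp
  qed
  obtain p where p: "walk r p (T e)" using assms(4) by (auto simp: linked_def)
  then have "walk r (p @ [e]) (H e)" using assms(3) by (auto simp: walk_append)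
  then show ?thesis unfolding shifted_defect_def
    using pot[of "T e", OF _ p] pot[of "H e"] zero[OF assms(3)] T_range[of e] H_range[of e] assms(3)
    by auto
qed

text \<open>The first part prepares the analysis with \<open>f\<close> as the weighting:
  \<open>g = d f\<close> makes its defects zero. For the second, the tail of an arc of a dicycle is
  taken as root. All arcs of the dicycle are linked to it, and the vanishing shifted defects sum to
  \<open>d (1 - f(C))\<close> with \<open>d\<close> positive.\<close>

lemma test_criterion:
  fixes f :: "int \<Rightarrow> real"
  assumes w: "index_weighting w" and d: "s ''d'' 0 > 0"
    and g: "\<And>e. arc e \<Longrightarrow> real_of_int (s ''g'' e) = s ''d'' 0 * f e"
  shows "index_weighting f \<Longrightarrow> arc e \<Longrightarrow> defect f s e = 0"
    "(\<And>r e. vert r \<Longrightarrow> arc e \<Longrightarrow> linked r e \<Longrightarrow> shifted_defect w s r e = 0) \<Longrightarrow> index_weighting f"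
proof -
  show "defect f s e = 0" if "arc e" using g[OF that] by (simp add: defect_def)
  assume zero: "\<And>r e. vert r \<Longrightarrow> arc e \<Longrightarrow> linked r e \<Longrightarrow> shifted_defect w s r e = 0"
  show "index_weighting f" unfolding index_weighting_def
  proof (intro allI impI)
    fix C assume C: "dicycle C"
    then obtain e0 where e0: "e0 \<in> set C" by (cases C) (auto simp: dicycle_def)
    have arcs: "arc e" if "e \<in> set C" for e using dicycle_arc[OF C that] .
    have "shifted_defect w s (T e0) e = 0" if "e \<in> set C" for e
      using zero[of "T e0" e] T_range[of e0] arcs e0 that
        linked_dicycle[OF C e0 that linked_tail[OF C e0]] by blast
    then have "map (shifted_defect w s (T e0)) C = map (\<lambda>e. 0) C" by (intro map_cong) auto
    then have "(\<Sum>e\<leftarrow>C. shifted_defect w s (T e0) e) = (\<Sum>e\<leftarrow>C. 0)" by (rule arg_cong)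
    then have "(\<Sum>e\<leftarrow>C. shifted_defect w s (T e0) e) = 0" by simp
    then have "s ''d'' 0 = (\<Sum>e\<leftarrow>C. real_of_int (s ''g'' e))"
      using sum_shifted_defect[OF C, of w s "T e0"] sum_defect[OF C w, of s] by simp
    also have "\<dots> = (\<Sum>e\<leftarrow>C. s ''d'' 0 * f e)"
      by (rule arg_cong[of _ _ sum_list], rule map_cong) (use g arcs in auto)
    also have "\<dots> = s ''d'' 0 * sum_list (map f C)" by (rule sum_list_const_mult)
    finally show "sum_list (map f C) = 1" using d by simp
  qed
qed

end

section \<open>Reading the input and writing the output\<close>

lemma length_pairs: "length (concat (map (\<lambda>e. [a e, b e]) es)) = 2 * length es"
  by (induction es) auto

lemma nth_pairs:
  assumes "i < length es"
  shows "concat (map (\<lambda>e. [a e, b e]) es) ! (2 * i) = a (es ! i)"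
    "concat (map (\<lambda>e. [a e, b e]) es) ! (2 * i + 1) = b (es ! i)"
  using assms by (induction es arbitrary: i) (auto simp: nth_Cons split: nat.split)

lemma input_store_in: "i < length xs \<Longrightarrow> input_store xs ''in'' (1 + int i) = xs ! i"
  by (simp add: input_store_def)

lemma input_store_other: "\<forall>x i. x \<noteq> ''in'' \<longrightarrow> input_store xs x i = 0"
  by (simp add: input_store_def)

context enumerated_digraph
begin

lemma input_store_order_size:
  "input_store (digraph_code G vs es @ rest) ''in'' 1 = nv"
  "input_store (digraph_code G vs es @ rest) ''in'' 2 = na"
  using input_store_in[of 0 "digraph_code G vs es @ rest"]
    input_store_in[of 1 "digraph_code G vs es @ rest"]
  by (simp_all add: digraph_code_def nv_def na_def)

lemma input_size_ge:
  assumes "k = 1 \<or> k = 2"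
  shows "nat (input_store (digraph_code G vs es @ rest) ''in'' k)
    \<le> length (digraph_code G vs es @ rest)"
  using assms input_store_order_size[of rest]
  by (auto simp: nv_def na_def digraph_code_def length_pairs)

lemma graph_in_input_store: "ix.graph_in (input_store (digraph_code G vs es @ rest))"
  unfolding ix.graph_in_def
proof (intro conjI allI impI)
  let ?xs = "digraph_code G vs es @ rest"
  show "input_store ?xs ''in'' 1 = nv" "input_store ?xs ''in'' 2 = na"
    by (rule input_store_order_size)+
  fix e assume e: "ix.arc e"
  define k where "k = nat e"
  have k: "k < length es" "e = int k" using e by (auto simp: k_def na_def)
  let ?p = "concat (map (\<lambda>e. [position vs (tail G e), position vs (head G e)]) es)"
  have len: "2 * k + 1 < length ?p" using k by (simp add: length_pairs)
  have at: "input_store ?xs ''in'' (3 + int (length vs + l)) = ?p ! l" if l: "l < length ?p" for l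
  proof -
    have "?xs ! (2 + length vs + l) = ?p ! l"
      using l by (simp add: digraph_code_def nth_append)
    moreover have "2 + length vs + l < length ?xs" using l by (simp add: digraph_code_def)
    ultimately show ?thesis using input_store_in[of "2 + length vs + l" ?xs] by (simp add: add.assoc)
  qed
  have "3 + (nv + (e + e)) = 3 + int (length vs + 2 * k)" using k by (simp add: nv_def)
  then show "input_store ?xs ''in'' (3 + (nv + (e + e))) = tl_at e"
    using at[of "2 * k"] len nth_pairs(1)[OF k(1)] k by (simp add: tl_at_def arc_at_def)
  have "4 + (nv + (e + e)) = 3 + int (length vs + (2 * k + 1))" using k by (simp add: nv_def)
  then show "input_store ?xs ''in'' (4 + (nv + (e + e))) = hd_at e"
    using at[of "2 * k + 1"] len nth_pairs(2)[OF k(1)] k by (simp add: hd_at_def arc_at_def)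
qed

lemma function_in_input_store:
  fixes f :: "'b \<Rightarrow> rat"
  assumes e: "ix.arc e"
  defines "s \<equiv> input_store (digraph_code G vs es @ function_code es f)"
  shows "s ''in'' (3 + (nv + ((na + na) + (e + e)))) = fst (quotient_of (f (arc_at e)))"
    "s ''in'' (4 + (nv + ((na + na) + (e + e)))) = snd (quotient_of (f (arc_at e)))"
proof -
  let ?xs = "digraph_code G vs es @ function_code es f"
  define k where "k = nat e"
  have k: "k < length es" "e = int k" using e by (auto simp: k_def na_def)
  have lf: "length (function_code es f) = 2 * length es"
    by (simp add: function_code_def length_pairs)
  let ?n = "2 + length vs + 2 * length es"
  have ld: "length (digraph_code G vs es) = ?n" by (simp add: digraph_code_def length_pairs)
  have at: "s ''in'' (1 + int (?n + l)) = function_code es f ! l" if l: "l < 2 * length es" for l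
  proof -
    have "?xs ! (?n + l) = function_code es f ! l" using ld by (metis nth_append_length_plus)
    moreover have "?n + l < length ?xs" using l ld lf by simp
    ultimately show ?thesis using input_store_in[of "?n + l" ?xs] by (simp add: s_def)
  qed
  have i3: "3 + (nv + ((na + na) + (e + e))) = 1 + int (?n + 2 * k)"
    using k by (simp add: nv_def na_def)
  show "s ''in'' (3 + (nv + ((na + na) + (e + e)))) = fst (quotient_of (f (arc_at e)))"
    unfolding i3 using at[of "2 * k"] nth_pairs(1)[OF k(1)] k by (simp add: function_code_def arc_at_def)
  have i4: "4 + (nv + ((na + na) + (e + e))) = 1 + int (?n + (2 * k + 1))"
    using k by (simp add: nv_def na_def)
  show "s ''in'' (4 + (nv + ((na + na) + (e + e)))) = snd (quotient_of (f (arc_at e)))"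
    unfolding i4 using at[of "2 * k + 1"] nth_pairs(2)[OF k(1)] k by (simp add: function_code_def arc_at_def)
qed

end

subsection \<open>The program finding a weighting\<close>

text \<open>The values found are integers, whose reduced fractions have denominator 1; these ones go
  to the even cells 2 + 2 e, away from the numerators. Cell 0 receives the length of the
  output.\<close>

definition find_program :: prog where
  "find_program = set_var ''d'' (Const 1) ;; reach ;; find_loop ;;
     For ''e'' 2 (Assign ''out'' (Plus (Const 2) (Plus (var ''e'') (var ''e''))) (Const 1)) ;;
     set_var ''out'' (Plus (Read ''in'' (Const 2)) (Read ''in'' (Const 2)))"

lemma tame_find_program: "tame find_program"
  by (simp add: find_program_def)

lemma (in index_digraph) run_find_program:
  assumes g: "graph_in s" and zero: "\<forall>x i. x \<noteq> ''in'' \<longrightarrow> s x i = 0" and w: "index_weighting w"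
  defines "s' \<equiv> run find_program s"
  shows "index_weighting (\<lambda>e. real_of_int (s' ''out'' (1 + (e + e))))" "s' ''out'' 0 = m + m"
    "\<And>e. arc e \<Longrightarrow> s' ''out'' (2 + (e + e)) = 1"
proof -
  define s1 where "s1 = upd ''d'' 0 1 s"
  define s2 where "s2 = run reach s1"
  define s3 where "s3 = run find_loop s2"
  let ?c = "Assign ''out'' (Plus (Const 2) (Plus (var ''e'') (var ''e''))) (Const 1)"
  define s4 where "s4 = run (For ''e'' 2 ?c) s3"
  have in1: "s1 ''in'' = s ''in''" by (simp add: s1_def)
  have in2: "s2 ''in'' = s ''in''" using in1 by (simp add: s2_def run_frame)
  have in3: "s3 ''in'' = s ''in''" using in2 by (simp add: s3_def run_frame)
  have in4: "s4 ''in'' = s ''in''" using in3 by (simp add: s4_def run_frame)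
  have g1: "graph_in s1" and g2: "graph_in s2"
    using g in1 in2 graph_in_cong[of s1 s] graph_in_cong[of s2 s] by auto
  have "s1 ''rc'' i = 0" for i using zero by (simp add: s1_def)
  then have tables: "reach_ok s2 t" if "vert t" for t
    unfolding s2_def by (rule run_reach[OF g1 _ that])
  have "s2 ''d'' 0 = 1" "s2 ''g'' e = 0" for e
    using zero by (simp_all add: s2_def run_frame s1_def upd_same)
  note w3 = run_find_loop[OF g2 w tables this, folded s3_def]
  define P where "P j s' \<longleftrightarrow> (\<forall>e. s' ''out'' (1 + (e + e)) = s3 ''out'' (1 + (e + e))) \<and>
    (\<forall>e. 0 \<le> e \<longrightarrow> e < int j \<longrightarrow> s' ''out'' (2 + (e + e)) = 1)" for j :: nat and s' :: store
  have "P (nat m) s4" unfolding s4_def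
  proof (rule run_For_invariant)
    show "P 0 (upd ''e'' 0 0 s3)" by (simp add: P_def)
    show "nat m = nat (s3 ''in'' 2)" using g in3 by (simp add: graph_in_def)
    fix j s' assume j: "s' ''e'' 0 = int j" and P: "P j s'"
    have out: "run ?c s' ''out'' = (s' ''out'')(2 + (int j + int j) := 1)"
      using j by (simp add: upd_def)
    have "1 + (e + e) \<noteq> 2 + (int j + int j)" for e by presburger
    then have "P (Suc j) (run ?c s')" using P unfolding P_def out by auto
    then show "P (Suc j) (upd ''e'' 0 (int (Suc j)) (run ?c s'))" by (simp add: P_def)
  qed auto
  then have s4: "\<And>e. s4 ''out'' (1 + (e + e)) = s3 ''out'' (1 + (e + e))"
    "\<And>e. arc e \<Longrightarrow> s4 ''out'' (2 + (e + e)) = 1"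
    by (auto simp: P_def)
  have "s' = upd ''out'' 0 (m + m) s4"
    using g in4 by (simp add: s'_def find_program_def s1_def s2_def s3_def s4_def graph_in_def)
  then have out: "s' ''out'' = (s4 ''out'')(0 := m + m)" by (simp add: upd_def)
  have "1 + (e + e) \<noteq> 0" for e :: int by presburger
  then have "s' ''out'' (1 + (e + e)) = s3 ''out'' (1 + (e + e))" for e
    unfolding out using s4(1) by simp
  then show "index_weighting (\<lambda>e. real_of_int (s' ''out'' (1 + (e + e))))" using w3 by simp
  show "s' ''out'' 0 = m + m" by (simp add: out)
  show "s' ''out'' (2 + (e + e)) = 1" if "arc e" for e
    unfolding out using s4(2)[OF that] that by simp
qed

text \<open>The real weighting \<open>w0\<close> justifies the run; the weighting returned is the
  integral one in the output cells. Thus a weightable digraph even has an integral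
  weighting.\<close>

lemma (in enumerated_digraph) find_correct:
  assumes "weightable G"
  defines "s \<equiv> run find_program (input_store (digraph_code G vs es))"
  shows "\<exists>w. weighting G (\<lambda>e. of_rat (w e)) \<and> output_list s = function_code es w"
proof -
  obtain w0 where "weighting G w0" using assms(1) by (auto simp: weightable_def)
  then have w0: "ix.index_weighting (\<lambda>i. w0 (arc_at i))" by (simp add: weighting_iff)
  have g: "ix.graph_in (input_store (digraph_code G vs es))"
    using graph_in_input_store[of "[]"] by simp
  note find = ix.run_find_program[OF g input_store_other w0, folded s_def]
  define w where "w b = rat_of_int (s ''out'' (1 + (position es b + position es b)))" for b
  have pos: "position es (es ! k) = int k" if "k < length es" for k
    using position_nth[OF es(1) that] .
  have w_at: "w (arc_at i) = rat_of_int (s ''out'' (1 + (i + i)))" if "ix.arc i" for i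
    using that pos[of "nat i"] by (simp add: w_def arc_at_def na_def nat_less_iff)
  have "(\<Sum>i\<leftarrow>p. real_of_rat (w (arc_at i))) = 1" if p: "ix.dicycle p" for p
  proof -
    have "map (\<lambda>i. real_of_rat (w (arc_at i))) p = map (\<lambda>i. real_of_int (s ''out'' (1 + (i + i)))) p"
      by (rule map_cong) (use w_at ix.dicycle_arc[OF p] in auto)
    then show ?thesis using find(1) p unfolding ix.index_weighting_def by metis
  qed
  then have "weighting G (\<lambda>e. of_rat (w e))" unfolding weighting_iff ix.index_weighting_def by blast
  moreover have "output_list s = function_code es w"
  proof (rule nth_equalityI)
    have len: "length (function_code es w) = 2 * length es"
      by (simp add: function_code_def length_pairs)
    then show "length (output_list s) = length (function_code es w)"
      using find(2) by (simp add: output_list_def na_def)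
    fix k assume "k < length (output_list s)"
    then have k: "k < 2 * length es" using find(2) by (simp add: output_list_def na_def)
    define i where "i = k div 2"
    have i: "i < length es" "ix.arc (int i)" using k by (auto simp: i_def na_def)
    have out: "output_list s ! k = s ''out'' (1 + int k)"
      using k find(2) by (simp add: output_list_def na_def nth_upto)
    have q: "quotient_of (w (es ! i)) = (s ''out'' (1 + (int i + int i)), 1)"
      unfolding w_def pos[OF i(1)] by (simp add: quotient_of_int)
    show "output_list s ! k = function_code es w ! k"
    proof (cases "even k")
      case True
      then have "k = 2 * i" by (simp add: i_def)
      then show ?thesis using out q
          nth_pairs(1)[OF i(1), of "\<lambda>e. fst (quotient_of (w e))" "\<lambda>e. snd (quotient_of (w e))"] by (simp add: function_code_def)
    next
      case False
      then have "k = 2 * i + 1" unfolding i_def by presburger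
      then show ?thesis using out q find(3)[OF i(2)]
          nth_pairs(2)[OF i(1), of "\<lambda>e. fst (quotient_of (w e))" "\<lambda>e. snd (quotient_of (w e))"]
        by (simp add: function_code_def)
    qed
  qed
  ultimately show ?thesis by blast
qed

subsection \<open>The program testing a function\<close>

text \<open>The digraph code fills the 2 + n + 2 m cells after cell 0, so the fraction of arc e
  stands at 3 + n + 2 m + 2 e and the cell after it.\<close>

abbreviation num_exp :: "exp \<Rightarrow> exp" where
  "num_exp e \<equiv> Read ''in'' (Plus (Const 3) (Plus order_exp
     (Plus (Plus (Read ''in'' (Const 2)) (Read ''in'' (Const 2))) (Plus e e))))"
abbreviation den_exp :: "exp \<Rightarrow> exp" where
  "den_exp e \<equiv> Read ''in'' (Plus (Const 4) (Plus order_exp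
     (Plus (Plus (Read ''in'' (Const 2)) (Read ''in'' (Const 2))) (Plus e e))))"

text \<open>The product of all denominators avoids the divisions that a least common multiple would
  take, and its factors are input cells, as \<open>tame_exp\<close> demands.\<close>

definition common_den :: prog where
  "common_den = set_var ''d'' (Const 1) ;;
     For ''e'' 2 (set_var ''d'' (Times (var ''d'') (den_exp (var ''e''))))"

text \<open>Multiplying the numerator by the denominators of all other arcs gives \<open>d\<close>
  times the value at \<open>e\<close> without a division.\<close>

definition scale_value :: prog where
  "scale_value = Assign ''g'' (var ''e'') (num_exp (var ''e'')) ;;
     For ''a'' 2 (if_eq (var ''a'') (var ''e'') Halt
       (Assign ''g'' (var ''e'') (Times (Read ''g'' (var ''e'')) (den_exp (var ''a'')))))"

definition test_program :: prog where
  "test_program = common_den ;; For ''e'' 2 scale_value ;; reach ;; test_loop ;;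
     set_var ''out'' (Const 1) ;; Assign ''out'' (Const 1) (Minus (Const 1) (var ''bad''))"

lemma writes_common_den [simp]: "writes common_den = {''d'', ''e''}"
  and writes_scale_value [simp]: "writes scale_value = {''g'', ''a''}"
  by (auto simp: common_den_def scale_value_def)

lemma tame_test_program: "tame test_program"
  by (simp add: test_program_def common_den_def scale_value_def)

section \<open>Clearing denominators, and correctness of the test\<close>

context index_digraph
begin

definition fractions_in :: "(int \<Rightarrow> int) \<Rightarrow> (int \<Rightarrow> int) \<Rightarrow> store \<Rightarrow> bool" where
  "fractions_in p q s \<longleftrightarrow> graph_in s \<and> (\<forall>e. arc e \<longrightarrow>
     s ''in'' (3 + (n + ((m + m) + (e + e)))) = p e \<and> s ''in'' (4 + (n + ((m + m) + (e + e)))) = q e)"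

lemma fractions_in_cong: "s' ''in'' = s ''in'' \<Longrightarrow> fractions_in p q s' \<longleftrightarrow> fractions_in p q s"
  by (simp add: fractions_in_def graph_in_def)

lemma val_fractions:
  assumes "fractions_in p q s" "val a s = e" "arc e"
  shows "val (num_exp a) s = p e" "val (den_exp a) s = q e"
proof -
  have "s ''in'' 1 = n" "s ''in'' 2 = m" using assms(1) by (auto simp: fractions_in_def graph_in_def)
  moreover have "s ''in'' (3 + (n + ((m + m) + (e + e)))) = p e"
    "s ''in'' (4 + (n + ((m + m) + (e + e)))) = q e" using assms by (auto simp: fractions_in_def)
  ultimately show "val (num_exp a) s = p e" "val (den_exp a) s = q e" using assms(2) by simp_all
qed

lemma run_common_den:
  assumes f: "fractions_in p q s"
  shows "run common_den s ''d'' 0 = (\<Prod>i<nat m. q (int i))"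
proof -
  let ?c = "set_var ''d'' (Times (var ''d'') (den_exp (var ''e'')))"
  define P where "P j s' \<longleftrightarrow> s' ''d'' 0 = (\<Prod>i<j. q (int i))" for j and s' :: store
  have "P (nat m) (run (For ''e'' 2 ?c) (upd ''d'' 0 1 s))"
  proof (rule run_For_invariant)
    show "P 0 (upd ''e'' 0 0 (upd ''d'' 0 1 s))" by (simp add: P_def upd_same)
    show "nat m = nat (upd ''d'' 0 1 s ''in'' 2)"
      using f by (simp add: fractions_in_def graph_in_def)
    fix j s' assume j: "j < nat m" "s' ''e'' 0 = int j" and P: "P j s'"
      and fr: "\<And>x. x \<noteq> ''e'' \<Longrightarrow> x \<notin> writes ?c \<Longrightarrow> s' x = upd ''d'' 0 1 s x"
    have f': "fractions_in p q s'" using f fr by (subst fractions_in_cong[of _ s]) auto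
    have den: "val (den_exp (var ''e'')) s' = q (int j)"
      by (rule val_fractions[OF f']) (use j in auto)
    have "run ?c s' = upd ''d'' 0 (s' ''d'' 0 * val (den_exp (var ''e'')) s') s'" by simp
    then have "run ?c s' ''d'' 0 = s' ''d'' 0 * q (int j)" unfolding den by (simp only: upd_same) simp
    then have "P (Suc j) (run ?c s')" using P by (simp add: P_def)
    then show "P (Suc j) (upd ''e'' 0 (int (Suc j)) (run ?c s'))" by (simp add: P_def)
  qed auto
  then show ?thesis by (simp add: common_den_def P_def)
qed

lemma run_scale_value:
  assumes f: "fractions_in p q s" and e: "s ''e'' 0 = e" "arc e"
  shows "run scale_value s ''g'' = (s ''g'')(e := p e * (\<Prod>i\<in>{..<nat m} - {nat e}. q (int i)))"
proof -
  let ?b = "Assign ''g'' (var ''e'') (Times (Read ''g'' (var ''e'')) (den_exp (var ''a'')))"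
  let ?c = "if_eq (var ''a'') (var ''e'') Halt ?b"
  define s1 where "s1 = upd ''g'' e (p e) s"
  define P where "P j s' \<longleftrightarrow> s' ''g'' = (s ''g'')(e := p e * (\<Prod>i\<in>{..<j} - {nat e}. q (int i)))"
    for j and s' :: store
  have "P (nat m) (run (For ''a'' 2 ?c) s1)"
  proof (rule run_For_invariant)
    show "P 0 (upd ''a'' 0 0 s1)" by (simp add: P_def s1_def upd_def)
    show "nat m = nat (s1 ''in'' 2)"
      using f by (simp add: fractions_in_def graph_in_def s1_def)
    fix j s' assume j: "j < nat m" "s' ''a'' 0 = int j" and P: "P j s'"
      and fr: "\<And>x. x \<noteq> ''a'' \<Longrightarrow> x \<notin> writes ?c \<Longrightarrow> s' x = s1 x"
    have f': "fractions_in p q s'"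
      using f fr by (subst fractions_in_cong[of _ s]) (auto simp: s1_def)
    have e': "s' ''e'' 0 = e" using fr e by (simp add: s1_def)
    have den: "val (den_exp (var ''a'')) s' = q (int j)"
      by (rule val_fractions[OF f']) (use j in auto)
    have g': "run ?c s' ''g'' = (if int j = e then s' ''g'' else
        (s' ''g'')(e := s' ''g'' e * q (int j)))"
    proof (cases "int j = e")
      case False
      then have "run ?c s' = run ?b s'" using j e' by simp
      also have "\<dots> = upd ''g'' e (s' ''g'' e * val (den_exp (var ''a'')) s') s'" using e' by simp
      finally show ?thesis unfolding den using False by (simp add: upd_def)
    qed (use j e' in simp)
    have "P (Suc j) (run ?c s')"
    proof (cases "int j = e")
      case True
      then have "{..<Suc j} - {nat e} = {..<j} - {nat e}" by auto
      then show ?thesis using P True unfolding P_def g' by simp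
    next
      case False
      then have "nat e \<noteq> j" using e by auto
      then have "{..<Suc j} - {nat e} = insert j ({..<j} - {nat e})" by auto
      then show ?thesis using P False unfolding P_def g' by (simp add: mult_ac)
    qed
    moreover have "upd ''a'' 0 v s'' ''g'' = s'' ''g''" for v s'' by simp
    ultimately show "P (Suc j) (upd ''a'' 0 (int (Suc j)) (run ?c s'))" by (simp only: P_def)
  qed auto
  moreover have "run scale_value s = run (For ''a'' 2 ?c) s1"
  proof -
    have "val (num_exp (var ''e'')) s = p e" by (rule val_fractions[OF f]) (use e in auto)
    then have "run (Assign ''g'' (var ''e'') (num_exp (var ''e''))) s = s1"
      unfolding run.simps using e by (simp add: s1_def)
    then show ?thesis by (simp only: scale_value_def run.simps(3))
  qed
  ultimately show ?thesis by (simp add: P_def)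
qed

lemma run_scale_values:
  assumes f: "fractions_in p q s" and e: "arc e"
  shows "run (For ''e'' 2 scale_value) s ''g'' e = p e * (\<Prod>i\<in>{..<nat m} - {nat e}. q (int i))"
proof -
  let ?g = "\<lambda>e. p e * (\<Prod>i\<in>{..<nat m} - {nat e}. q (int i))"
  define P where "P j s' \<longleftrightarrow> (\<forall>e. 0 \<le> e \<longrightarrow> e < int j \<longrightarrow> s' ''g'' e = ?g e)"
    for j :: nat and s' :: store
  have "P (nat m) (run (For ''e'' 2 scale_value) s)"
  proof (rule run_For_invariant)
    show "P 0 (upd ''e'' 0 0 s)" by (simp add: P_def)
    show "nat m = nat (s ''in'' 2)" using f by (simp add: fractions_in_def graph_in_def)
    fix j s' assume j: "j < nat m" "s' ''e'' 0 = int j" and P: "P j s'"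
      and fr: "\<And>x. x \<noteq> ''e'' \<Longrightarrow> x \<notin> writes scale_value \<Longrightarrow> s' x = s x"
    have f': "fractions_in p q s'" using f fr by (subst fractions_in_cong[of _ s]) auto
    have "run scale_value s' ''g'' = (s' ''g'')(int j := ?g (int j))"
      by (rule run_scale_value[OF f' j(2)]) (use j in auto)
    then have "P (Suc j) (run scale_value s')" using P by (auto simp: P_def)
    then show "P (Suc j) (upd ''e'' 0 (int (Suc j)) (run scale_value s'))" by (simp add: P_def)
  qed auto
  then show ?thesis using e by (simp add: P_def)
qed

lemma run_test_program:
  fixes f :: "int \<Rightarrow> real"
  assumes fr: "fractions_in p q s" and zero: "\<forall>x i. x \<noteq> ''in'' \<longrightarrow> s x i = 0"
    and w0: "index_weighting w0" and q: "\<And>e. arc e \<Longrightarrow> q e > 0"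
    and f: "\<And>e. arc e \<Longrightarrow> f e = p e / q e"
  shows "output_list (run test_program s) = (if index_weighting f then [1] else [0])"
proof -
  define s1 where "s1 = run common_den s"
  define s2 where "s2 = run (For ''e'' 2 scale_value) s1"
  define s3 where "s3 = run reach s2"
  define s4 where "s4 = run test_loop s3"
  have in1: "s1 ''in'' = s ''in''" by (simp add: s1_def run_frame)
  have in2: "s2 ''in'' = s ''in''" using in1 by (simp add: s2_def run_frame)
  have in3: "s3 ''in'' = s ''in''" using in2 by (simp add: s3_def run_frame)
  have fr1: "fractions_in p q s1" using fr in1 fractions_in_cong[of s1 s] by simp
  have g: "graph_in s" using fr by (simp add: fractions_in_def)
  then have g2: "graph_in s2" and g3: "graph_in s3"
    using in2 in3 graph_in_cong[of s2 s] graph_in_cong[of s3 s] by auto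
  have "s2 ''rc'' i = 0" for i using zero by (simp add: s2_def s1_def run_frame)
  then have tables: "reach_ok s3 t" if "vert t" for t
    unfolding s3_def by (rule run_reach[OF g2 _ that])
  have bad3: "s3 ''bad'' 0 = 0" using zero by (simp add: s3_def s2_def s1_def run_frame)
  have d3: "s3 ''d'' 0 = (\<Prod>i<nat m. q (int i))"
    using run_common_den[OF fr] by (simp add: s3_def s2_def s1_def run_frame)
  have g3': "s3 ''g'' e = p e * (\<Prod>i\<in>{..<nat m} - {nat e}. q (int i))" if "arc e" for e
    using run_scale_values[OF fr1 that] by (simp add: s3_def s2_def run_frame)
  have pos: "s3 ''d'' 0 > 0" unfolding d3 using q by (intro prod_pos) auto
  have scaled: "real_of_int (s3 ''g'' e) = s3 ''d'' 0 * f e" if e: "arc e" for e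
  proof -
    have "(\<Prod>i<nat m. q (int i)) = q e * (\<Prod>i\<in>{..<nat m} - {nat e}. q (int i))"
      using e prod.remove[of "{..<nat m}" "nat e" "\<lambda>i. q (int i)"] by auto
    then show ?thesis using g3'[OF e] q[OF e] unfolding d3 by (simp add: f[OF e])
  qed
  \<comment> \<open>The run does not depend on the weighting used to analyse it, so the choice may
    depend on the answer: with \<open>w = f\<close> all defects are zero, and otherwise
    \<open>w0\<close> exposes a nonzero shifted defect.\<close>
  define w where "w = (if index_weighting f then f else w0)"
  have w: "index_weighting w" using w0 by (simp add: w_def)
  have "index_weighting f \<longleftrightarrow>
      \<not> (\<exists>r e. vert r \<and> arc e \<and> linked r e \<and> shifted_defect w s3 r e \<noteq> 0)"
  proof
    assume iw: "index_weighting f"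
    then have "defect w s3 e = 0" if "arc e" for e
      using test_criterion(1)[where s = s3 and f = f, OF w pos scaled iw that] by (simp add: w_def)
    then show "\<not> (\<exists>r e. vert r \<and> arc e \<and> linked r e \<and> shifted_defect w s3 r e \<noteq> 0)"
      using shifted_defect_eq_0[OF tables] by blast
  next
    assume "\<not> (\<exists>r e. vert r \<and> arc e \<and> linked r e \<and> shifted_defect w s3 r e \<noteq> 0)"
    then show "index_weighting f" using test_criterion(2)[where s = s3 and f = f, OF w pos scaled] by blast
  qed
  then have bad: "s4 ''bad'' 0 = (if index_weighting f then 0 else 1)"
    using run_test_loop[OF g3 w tables bad3] by (auto simp: s4_def)
  have "run test_program s = upd ''out'' 1 (1 - s4 ''bad'' 0) (upd ''out'' 0 1 s4)"
    by (simp add: test_program_def s1_def s2_def s3_def s4_def)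
  then have "run test_program s ''out'' 0 = 1"
    "run test_program s ''out'' 1 = (if index_weighting f then 1 else 0)"
    using bad by (auto simp: upd_same)
  then show ?thesis by (auto simp: output_list_def)
qed

end

lemma (in enumerated_digraph) test_correct:
  assumes "weightable G"
  shows "output_list (run test_program (input_store (digraph_code G vs es @ function_code es f))) =
    (if weighting G (\<lambda>e. of_rat (f e)) then [1] else [0])"
proof -
  obtain w0 where "weighting G w0" using assms by (auto simp: weightable_def)
  then have w0: "ix.index_weighting (\<lambda>i. w0 (arc_at i))" by (simp add: weighting_iff)
  define p where "p i = fst (quotient_of (f (arc_at i)))" for i
  define q where "q i = snd (quotient_of (f (arc_at i)))" for i
  let ?s = "input_store (digraph_code G vs es @ function_code es f)"
  have fr: "ix.fractions_in p q ?s"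
    unfolding ix.fractions_in_def p_def q_def
    using graph_in_input_store function_in_input_store by blast
  have q: "q i > 0" for i unfolding q_def by (rule quotient_of_denom_pos')
  have "real_of_rat (f (arc_at i)) = p i / q i" for i
  proof -
    have "f (arc_at i) = of_int (p i) / of_int (q i)"
      by (rule quotient_of_div) (simp add: p_def q_def)
    then show ?thesis by (simp add: of_rat_divide)
  qed
  from ix.run_test_program[OF fr input_store_other w0 q this]
  show ?thesis unfolding weighting_iff .
qed

lemma enumerated_digraphI:
  "fin_digraph G \<Longrightarrow> enumerates vs (verts G) \<Longrightarrow> enumerates es (arcs G) \<Longrightarrow>
    enumerated_digraph G vs es"
  by (simp add: enumerated_digraph_def enumerated_digraph_axioms_def enumerates_def)

theorem mainTheorem3:
  shows
    "(\<exists>find. polytime_solves find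
        {(G :: ('a, 'b) pre_digraph, vs, es).
           fin_digraph G \<and> weightable G \<and> enumerates vs (verts G) \<and> enumerates es (arcs G)}
        (\<lambda>(G, vs, es). digraph_code G vs es)
        (\<lambda>(G, vs, es) ys. \<exists>w :: 'b \<Rightarrow> rat.
           weighting G (\<lambda>e. of_rat (w e)) \<and> ys = function_code es w))
   \<and> (\<exists>test. polytime_solves test
        {(G :: ('a, 'b) pre_digraph, vs, es, f :: 'b \<Rightarrow> rat).
           fin_digraph G \<and> weightable G \<and> enumerates vs (verts G) \<and> enumerates es (arcs G)}
        (\<lambda>(G, vs, es, f). digraph_code G vs es @ function_code es f)
        (\<lambda>(G, vs, es, f) ys. ys = (if weighting G (\<lambda>e. of_rat (f e)) then [1] else [0])))"
proof (intro conjI exI)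
  show "polytime_solves (compile find_program)
        {(G :: ('a, 'b) pre_digraph, vs, es).
           fin_digraph G \<and> weightable G \<and> enumerates vs (verts G) \<and> enumerates es (arcs G)}
        (\<lambda>(G, vs, es). digraph_code G vs es)
        (\<lambda>(G, vs, es) ys. \<exists>w :: 'b \<Rightarrow> rat.
           weighting G (\<lambda>e. of_rat (w e)) \<and> ys = function_code es w)"
  proof (rule polytime_solves_compile[OF tame_find_program], goal_cases)
    case (1 x k)
    obtain G vs es where x: "x = (G, vs, es)" by (cases x)
    have G: "enumerated_digraph G vs es" using 1(1) by (auto simp: x intro: enumerated_digraphI)
    show ?case unfolding x prod.case
      using enumerated_digraph.input_size_ge[OF G 1(2), of "[]"] by simp
  next
    case (2 x)
    obtain G vs es where x: "x = (G, vs, es)" by (cases x)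
    have "enumerated_digraph G vs es" "weightable G"
      using 2 by (auto simp: x intro: enumerated_digraphI)
    then show ?case unfolding x prod.case by (rule enumerated_digraph.find_correct)
  qed
  show "polytime_solves (compile test_program)
        {(G :: ('a, 'b) pre_digraph, vs, es, f :: 'b \<Rightarrow> rat).
           fin_digraph G \<and> weightable G \<and> enumerates vs (verts G) \<and> enumerates es (arcs G)}
        (\<lambda>(G, vs, es, f). digraph_code G vs es @ function_code es f)
        (\<lambda>(G, vs, es, f) ys. ys = (if weighting G (\<lambda>e. of_rat (f e)) then [1] else [0]))"
  proof (rule polytime_solves_compile[OF tame_test_program], goal_cases)
    case (1 x k)
    obtain G vs es f where x: "x = (G, vs, es, f)" by (cases x)
    have G: "enumerated_digraph G vs es" using 1(1) by (auto simp: x intro: enumerated_digraphI)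
    show ?case unfolding x prod.case by (rule enumerated_digraph.input_size_ge[OF G 1(2)])
  next
    case (2 x)
    obtain G vs es f where x: "x = (G, vs, es, f)" by (cases x)
    have "enumerated_digraph G vs es" "weightable G"
      using 2 by (auto simp: x intro: enumerated_digraphI)
    then show ?case unfolding x prod.case by (rule enumerated_digraph.test_correct)
  qed
qed

end
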